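(* Let $H$ be a finitely generated amenable group and let $\mathbb{f}$ be a finite field. If $H$ has a F\o lner tiling sequence, then $\mathsf{Shuffler}(H)$ has a F\o lner tiling sequence and $\mathsf{Cloner}_{\mathbb{f}}(H)$ has a F\o lner tiling sequence.
   Context: A (right) F\o lner tiling sequence of a finitely generated amenable group $G$ is a sequence $(F_n)_{n\ge 0}$ of non-empty finite subsets of $G$ that is a right F\o lner sequence ($|F_ng\setminus F_n|/|F_n|\to 0$ for every $g\in G$) and satisfies the tiling condition: for every $n\ge 0$ there is a finite subset $\Sigma_n\subset G$ such that the translates $gF_n$, $g\in\Sigma_n$, are pairwise disjoint and $F_{n+1}=\Sigma_nF_n$. For convenience one also normalizes $F_0=\{1_G\}$. $\mathsf{Shuffler}(H)=\mathsf{FSym}(H)\rtimes H$, where $\mathsf{FSym}(H)$ is the group of finitely supported permutations of $H$ and $(h\cdot\sigma)(x)=h\sigma(h^{-1}x)$. $\mathsf{Cloner}_{\mathbb{f}}(H)=\mathrm{FGL}(H)\rtimes H$, where $V_H$ is the $\mathbb{f}$-vector space with basis $(e_u)_{u\in H}$, $\mathrm{FGL}(H)$ is the group of linear automorphisms of $V_H$ fixing all but finitely many $e_u$, and $H$ acts on $\mathrm{FGL}(H)$ by conjugation through the permutation $e_u\mapsto e_{hu}$ of the basis. *)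

theory Defs
  imports
    Complex_Main
    "HOL-Library.Disjoint_Sets"
    "HOL-Algebra.Bij"
    "HOL-Algebra.Generated_Groups"
    "Jordan_Normal_Form.Missing_VectorSpace"
begin

section \<open>Finitely generated and amenable groups\<close>

definition finitely_generated :: "('a, 'm) monoid_scheme \<Rightarrow> bool" where
  "finitely_generated G \<longleftrightarrow> (\<exists>S. finite S \<and> S \<subseteq> carrier G \<and> generate G S = carrier G)"

text \<open>Amenability of a discrete group in the sense of von Neumann: there is a left-invariant
  finitely additive probability measure defined on all subsets.\<close>

definition amenable :: "('a, 'm) monoid_scheme \<Rightarrow> bool" where
  "amenable G \<longleftrightarrow>
    (\<exists>\<mu> :: 'a set \<Rightarrow> real.
      \<mu> (carrier G) = 1 \<and>
      (\<forall>A. A \<subseteq> carrier G \<longrightarrow> 0 \<le> \<mu> A) \<and>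
      (\<forall>A B. A \<subseteq> carrier G \<longrightarrow> B \<subseteq> carrier G \<longrightarrow> A \<inter> B = {} \<longrightarrow> \<mu> (A \<union> B) = \<mu> A + \<mu> B) \<and>
      (\<forall>g A. g \<in> carrier G \<longrightarrow> A \<subseteq> carrier G \<longrightarrow> \<mu> (g <#\<^bsub>G\<^esub> A) = \<mu> A))"

section \<open>Foelner tiling sequences\<close>

definition right_folner_sequence :: "('a, 'm) monoid_scheme \<Rightarrow> (nat \<Rightarrow> 'a set) \<Rightarrow> bool" where
  "right_folner_sequence G F \<longleftrightarrow>
    (\<forall>n. finite (F n) \<and> F n \<noteq> {} \<and> F n \<subseteq> carrier G) \<and>
    (\<forall>g \<in> carrier G.
      (\<lambda>n. real (card ((F n #>\<^bsub>G\<^esub> g) - F n)) / real (card (F n))) \<longlonglongrightarrow> 0)"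

definition tiling_condition :: "('a, 'm) monoid_scheme \<Rightarrow> (nat \<Rightarrow> 'a set) \<Rightarrow> bool" where
  "tiling_condition G F \<longleftrightarrow>
    (\<forall>n. \<exists>\<Sigma>. finite \<Sigma> \<and> \<Sigma> \<subseteq> carrier G \<and>
      disjoint_family_on (\<lambda>g. g <#\<^bsub>G\<^esub> F n) \<Sigma> \<and> F (Suc n) = \<Sigma> <#>\<^bsub>G\<^esub> F n)"

definition folner_tiling_sequence :: "('a, 'm) monoid_scheme \<Rightarrow> (nat \<Rightarrow> 'a set) \<Rightarrow> bool" where
  "folner_tiling_sequence G F \<longleftrightarrow>
    right_folner_sequence G F \<and> tiling_condition G F \<and> F 0 = {\<one>\<^bsub>G\<^esub>}"

section \<open>Semidirect products\<close>

definition semidirect ::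
  "('n, 'x) monoid_scheme \<Rightarrow> ('h, 'y) monoid_scheme \<Rightarrow> ('h \<Rightarrow> 'n \<Rightarrow> 'n) \<Rightarrow> ('n \<times> 'h) monoid" where
  "semidirect N H \<phi> =
    \<lparr>carrier = carrier N \<times> carrier H,
     mult = (\<lambda>(a, h) (b, k). (a \<otimes>\<^bsub>N\<^esub> \<phi> h b, h \<otimes>\<^bsub>H\<^esub> k)),
     one = (\<one>\<^bsub>N\<^esub>, \<one>\<^bsub>H\<^esub>)\<rparr>"

lemma group_semidirect:
  assumes N: "group N" and H: "group H"
    and hom: "\<And>h. h \<in> carrier H \<Longrightarrow> \<phi> h \<in> hom N N"
    and comp: "\<And>h k a. h \<in> carrier H \<Longrightarrow> k \<in> carrier H \<Longrightarrow> a \<in> carrier N \<Longrightarrow>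
      \<phi> (h \<otimes>\<^bsub>H\<^esub> k) a = \<phi> h (\<phi> k a)"
    and one: "\<And>a. a \<in> carrier N \<Longrightarrow> \<phi> \<one>\<^bsub>H\<^esub> a = a"
  shows "group (semidirect N H \<phi>)"
proof -
  interpret N: group N by (rule N)
  interpret H: group H by (rule H)
  have cl[simp]: "\<phi> h a \<in> carrier N" if "h \<in> carrier H" "a \<in> carrier N" for h a
    using hom[OF that(1)] that(2) by (auto simp: hom_def)
  have mu[simp]: "\<phi> h (a \<otimes>\<^bsub>N\<^esub> b) = \<phi> h a \<otimes>\<^bsub>N\<^esub> \<phi> h b"
    if "h \<in> carrier H" "a \<in> carrier N" "b \<in> carrier N" for h a b
    using hom[OF that(1)] that(2,3) by (auto simp: hom_def)
  show ?thesis
  proof (rule groupI)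
    fix x assume "x \<in> carrier (semidirect N H \<phi>)"
    then obtain a h where x: "x = (a, h)" "a \<in> carrier N" "h \<in> carrier H"
      by (auto simp: semidirect_def)
    let ?y = "(\<phi> (inv\<^bsub>H\<^esub> h) (inv\<^bsub>N\<^esub> a), inv\<^bsub>H\<^esub> h)"
    have "\<phi> (inv\<^bsub>H\<^esub> h) (inv\<^bsub>N\<^esub> a) \<otimes>\<^bsub>N\<^esub> \<phi> (inv\<^bsub>H\<^esub> h) a = \<phi> (inv\<^bsub>H\<^esub> h) \<one>\<^bsub>N\<^esub>"
      using x by (simp flip: mu)
    also have "\<dots> = \<one>\<^bsub>N\<^esub>"
      using hom_one[OF hom N N] x by simp
    finally show "\<exists>y\<in>carrier (semidirect N H \<phi>). y \<otimes>\<^bsub>semidirect N H \<phi>\<^esub> x = \<one>\<^bsub>semidirect N H \<phi>\<^esub>"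
      using x by (intro bexI[of _ ?y]) (auto simp: semidirect_def)
  qed (auto simp: semidirect_def N.m_assoc H.m_assoc comp one)
qed

section \<open>Shufflers\<close>

definition FSym :: "'a set \<Rightarrow> ('a \<Rightarrow> 'a) monoid" where
  "FSym S = BijGroup S \<lparr>carrier := {\<sigma> \<in> Bij S. finite {x \<in> S. \<sigma> x \<noteq> x}}\<rparr>"

definition FSym_action :: "('a, 'm) monoid_scheme \<Rightarrow> 'a \<Rightarrow> ('a \<Rightarrow> 'a) \<Rightarrow> 'a \<Rightarrow> 'a" where
  "FSym_action H h \<sigma> = (\<lambda>x \<in> carrier H. h \<otimes>\<^bsub>H\<^esub> \<sigma> (inv\<^bsub>H\<^esub> h \<otimes>\<^bsub>H\<^esub> x))"

definition Shuffler :: "('a, 'm) monoid_scheme \<Rightarrow> (('a \<Rightarrow> 'a) \<times> 'a) monoid" where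
  "Shuffler H = semidirect (FSym (carrier H)) H (FSym_action H)"

section \<open>Cloners\<close>

text \<open>The vector space with basis indexed by \<open>S\<close>: finitely supported functions on \<open>S\<close>,
  extended by zero to the ambient type. As for other vector spaces represented by module records,
  the ring multiplication and unit are irrelevant.\<close>

definition free_space :: "('f, 'r) ring_scheme \<Rightarrow> 'a set \<Rightarrow> ('f, 'a \<Rightarrow> 'f) module" where
  "free_space K S =
    \<lparr>carrier = {v. range v \<subseteq> carrier K \<and> {x. v x \<noteq> \<zero>\<^bsub>K\<^esub>} \<subseteq> S \<and> finite {x. v x \<noteq> \<zero>\<^bsub>K\<^esub>}},
     mult = undefined,
     one = undefined,
     zero = (\<lambda>x. \<zero>\<^bsub>K\<^esub>),
     add = (\<lambda>v w x. v x \<oplus>\<^bsub>K\<^esub> w x),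
     smult = (\<lambda>c v x. c \<otimes>\<^bsub>K\<^esub> v x)\<rparr>"

definition basis_vec :: "('f, 'r) ring_scheme \<Rightarrow> 'a \<Rightarrow> 'a \<Rightarrow> 'f" where
  "basis_vec K u = (\<lambda>x. if x = u then \<one>\<^bsub>K\<^esub> else \<zero>\<^bsub>K\<^esub>)"

definition FGL :: "('f, 'r) ring_scheme \<Rightarrow> 'a set \<Rightarrow> (('a \<Rightarrow> 'f) \<Rightarrow> ('a \<Rightarrow> 'f)) monoid" where
  "FGL K S = BijGroup (carrier (free_space K S))
    \<lparr>carrier := {f \<in> Bij (carrier (free_space K S)).
        f \<in> module_hom K (free_space K S) (free_space K S) \<and>
        finite {u \<in> S. f (basis_vec K u) \<noteq> basis_vec K u}}\<rparr>"

text \<open>The linear map with \<open>e\<^sub>u \<mapsto> e\<^sub>h\<^sub>u\<close> (see \<open>translation_basis_vec\<close>): the coefficient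
  of the image at \<open>x\<close> is the coefficient of the argument at \<open>h\<inverse>x\<close>.\<close>

definition translation ::
  "('f, 'r) ring_scheme \<Rightarrow> ('a, 'm) monoid_scheme \<Rightarrow> 'a \<Rightarrow> ('a \<Rightarrow> 'f) \<Rightarrow> 'a \<Rightarrow> 'f" where
  "translation K H h = (\<lambda>v \<in> carrier (free_space K (carrier H)).
    \<lambda>x. if x \<in> carrier H then v (inv\<^bsub>H\<^esub> h \<otimes>\<^bsub>H\<^esub> x) else \<zero>\<^bsub>K\<^esub>)"

definition FGL_action ::
  "('f, 'r) ring_scheme \<Rightarrow> ('a, 'm) monoid_scheme \<Rightarrow> 'a \<Rightarrow>
    (('a \<Rightarrow> 'f) \<Rightarrow> ('a \<Rightarrow> 'f)) \<Rightarrow> (('a \<Rightarrow> 'f) \<Rightarrow> ('a \<Rightarrow> 'f))" where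
  "FGL_action K H h f =
    (let B = BijGroup (carrier (free_space K (carrier H)))
     in translation K H h \<otimes>\<^bsub>B\<^esub> f \<otimes>\<^bsub>B\<^esub> inv\<^bsub>B\<^esub> (translation K H h))"

definition Cloner ::
  "('f, 'r) ring_scheme \<Rightarrow> ('a, 'm) monoid_scheme \<Rightarrow> ((('a \<Rightarrow> 'f) \<Rightarrow> ('a \<Rightarrow> 'f)) \<times> 'a) monoid" where
  "Cloner K H = semidirect (FGL K (carrier H)) H (FGL_action K H)"

section \<open>Basic properties\<close>

lemma BijGroup_simps:
  "carrier (BijGroup S) = Bij S"
  "f \<in> Bij S \<Longrightarrow> g \<in> Bij S \<Longrightarrow> f \<otimes>\<^bsub>BijGroup S\<^esub> g = compose S f g"
  "\<one>\<^bsub>BijGroup S\<^esub> = (\<lambda>x \<in> S. x)"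
  by (auto simp: BijGroup_def)

lemma subgroup_finite_support:
  assumes b: "b ` I \<subseteq> S"
  shows "subgroup {f \<in> Bij S. finite {u \<in> I. f (b u) \<noteq> b u}} (BijGroup S)"
proof (rule subgroup.intro)
  fix f g
  assume f: "f \<in> {f \<in> Bij S. finite {u \<in> I. f (b u) \<noteq> b u}}"
    and g: "g \<in> {f \<in> Bij S. finite {u \<in> I. f (b u) \<noteq> b u}}"
  have "{u \<in> I. compose S f g (b u) \<noteq> b u} \<subseteq> {u \<in> I. f (b u) \<noteq> b u} \<union> {u \<in> I. g (b u) \<noteq> b u}"
    using b by (auto simp: compose_def)
  with f g show "f \<otimes>\<^bsub>BijGroup S\<^esub> g \<in> {f \<in> Bij S. finite {u \<in> I. f (b u) \<noteq> b u}}"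
    by (auto simp: BijGroup_simps compose_Bij intro: finite_subset)
next
  fix f
  assume f: "f \<in> {f \<in> Bij S. finite {u \<in> I. f (b u) \<noteq> b u}}"
  have "inv_into S f (b u) = b u" if "u \<in> I" "f (b u) = b u" for u
    using that f b by (metis (no_types, lifting) Bij_def Int_iff bij_betw_def image_subset_iff
        inv_into_f_f mem_Collect_eq)
  hence "{u \<in> I. (\<lambda>x \<in> S. inv_into S f x) (b u) \<noteq> b u} \<subseteq> {u \<in> I. f (b u) \<noteq> b u}"
    using b by auto
  with f show "inv\<^bsub>BijGroup S\<^esub> f \<in> {f \<in> Bij S. finite {u \<in> I. f (b u) \<noteq> b u}}"
    by (auto simp del: restrict_apply
        simp: inv_BijGroup restrict_inv_into_Bij intro: finite_subset)
next
  have e: "{u \<in> I. (\<lambda>x \<in> S. x) (b u) \<noteq> b u} = {}"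
    using b by auto
  show "\<one>\<^bsub>BijGroup S\<^esub> \<in> {f \<in> Bij S. finite {u \<in> I. f (b u) \<noteq> b u}}"
    unfolding BijGroup_simps mem_Collect_eq e by (simp add: id_Bij del: restrict_apply)
qed (auto simp: BijGroup_simps)

lemma group_semidirect_conjugation:
  assumes B: "group B" and H: "group H" and N: "subgroup N B" and T: "T \<in> hom H B"
    and inv: "\<And>h a. h \<in> carrier H \<Longrightarrow> a \<in> N \<Longrightarrow> \<phi> h a \<in> N"
    and conj: "\<And>h a. h \<in> carrier H \<Longrightarrow> a \<in> N \<Longrightarrow> \<phi> h a = T h \<otimes>\<^bsub>B\<^esub> a \<otimes>\<^bsub>B\<^esub> inv\<^bsub>B\<^esub> (T h)"
  shows "group (semidirect (B\<lparr>carrier := N\<rparr>) H \<phi>)"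
proof -
  interpret B: group B by (rule B)
  interpret H: group H by (rule H)
  interpret N: subgroup N B by (rule N)
  have T1: "T \<one>\<^bsub>H\<^esub> = \<one>\<^bsub>B\<^esub>" by (rule hom_one[OF T H B])
  have Tc: "T h \<in> carrier B" if "h \<in> carrier H" for h using T that by (auto simp: hom_def)
  have Tm: "T (h \<otimes>\<^bsub>H\<^esub> k) = T h \<otimes>\<^bsub>B\<^esub> T k" if "h \<in> carrier H" "k \<in> carrier H" for h k
    using T that by (auto simp: hom_def)
  have canc: "inv\<^bsub>B\<^esub> x \<otimes>\<^bsub>B\<^esub> (x \<otimes>\<^bsub>B\<^esub> y) = y" if "x \<in> carrier B" "y \<in> carrier B" for x y
    using that by (simp flip: B.m_assoc)
  show ?thesis
  proof (rule group_semidirect)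
    show "group (B\<lparr>carrier := N\<rparr>)" using N B by (rule subgroup.subgroup_is_group)
    show "\<phi> h \<in> hom (B\<lparr>carrier := N\<rparr>) (B\<lparr>carrier := N\<rparr>)" if h: "h \<in> carrier H" for h
    proof (rule homI)
      fix a assume "a \<in> carrier (B\<lparr>carrier := N\<rparr>)"
      thus "\<phi> h a \<in> carrier (B\<lparr>carrier := N\<rparr>)" using inv[OF h] by simp
    next
      fix a b assume "a \<in> carrier (B\<lparr>carrier := N\<rparr>)" "b \<in> carrier (B\<lparr>carrier := N\<rparr>)"
      thus "\<phi> h (a \<otimes>\<^bsub>B\<lparr>carrier := N\<rparr>\<^esub> b) = \<phi> h a \<otimes>\<^bsub>B\<lparr>carrier := N\<rparr>\<^esub> \<phi> h b"
        using h Tc[OF h] by (simp add: conj B.m_assoc canc)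
    qed
    show "\<phi> (h \<otimes>\<^bsub>H\<^esub> k) a = \<phi> h (\<phi> k a)"
      if "h \<in> carrier H" "k \<in> carrier H" "a \<in> carrier (B\<lparr>carrier := N\<rparr>)" for h k a
    proof -
      have "a \<in> N" using that by simp
      show ?thesis using that \<open>a \<in> N\<close> Tc N.mem_carrier[OF \<open>a \<in> N\<close>]
        using conj[of h "\<phi> k a"] inv[of k a] conj[of k a] conj[of "h \<otimes>\<^bsub>H\<^esub> k" a]
        by (simp add: Tm B.m_assoc B.inv_mult_group)
    qed
    show "\<phi> \<one>\<^bsub>H\<^esub> a = a" if "a \<in> carrier (B\<lparr>carrier := N\<rparr>)" for a
      using that by (simp add: conj T1)
  qed (rule H)
qed

lemma finite_support_conjugation:
  assumes H: "group H" and b: "b ` carrier H \<subseteq> S" and T: "T \<in> hom H (BijGroup S)"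
    and Tb: "\<And>h u. h \<in> carrier H \<Longrightarrow> u \<in> carrier H \<Longrightarrow> T h (b u) = b (h \<otimes>\<^bsub>H\<^esub> u)"
    and h: "h \<in> carrier H" and f: "f \<in> Bij S" "finite {u \<in> carrier H. f (b u) \<noteq> b u}"
  shows "finite {u \<in> carrier H.
    (T h \<otimes>\<^bsub>BijGroup S\<^esub> f \<otimes>\<^bsub>BijGroup S\<^esub> inv\<^bsub>BijGroup S\<^esub> (T h)) (b u) \<noteq> b u}"
proof -
  interpret H: group H by (rule H)
  interpret T: group_hom H "BijGroup S" T
    by (simp add: group_hom_def group_hom_axioms_def H T group_BijGroup)
  have Tc: "T k \<in> Bij S" if "k \<in> carrier H" for k
    using T.hom_closed[OF that] by (simp add: BijGroup_simps)
  have *: "(T h \<otimes>\<^bsub>BijGroup S\<^esub> f \<otimes>\<^bsub>BijGroup S\<^esub> inv\<^bsub>BijGroup S\<^esub> (T h)) (b u)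
      = T h (f (b (inv\<^bsub>H\<^esub> h \<otimes>\<^bsub>H\<^esub> u)))" if u: "u \<in> carrier H" for u
  proof -
    have "b u \<in> S" "b (inv\<^bsub>H\<^esub> h \<otimes>\<^bsub>H\<^esub> u) \<in> S" using b u h by auto
    moreover have "inv\<^bsub>BijGroup S\<^esub> (T h) = T (inv\<^bsub>H\<^esub> h)"
      using T.hom_inv[OF h] by simp
    moreover have "T h \<in> Bij S" "T (inv\<^bsub>H\<^esub> h) \<in> Bij S" using h Tc by (auto simp del: T.hom_inv)
    ultimately show ?thesis using h u f
      by (simp add: BijGroup_simps(2) compose_Bij del: T.hom_inv)
        (simp add: compose_def Tb del: T.hom_inv)
  qed
  have "{u \<in> carrier H. (T h \<otimes>\<^bsub>BijGroup S\<^esub> f \<otimes>\<^bsub>BijGroup S\<^esub> inv\<^bsub>BijGroup S\<^esub> (T h)) (b u) \<noteq> b u}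
      \<subseteq> (\<lambda>u. h \<otimes>\<^bsub>H\<^esub> u) ` {u \<in> carrier H. f (b u) \<noteq> b u}"
  proof safe
    fix u assume u: "u \<in> carrier H"
      and ne: "(T h \<otimes>\<^bsub>BijGroup S\<^esub> f \<otimes>\<^bsub>BijGroup S\<^esub> inv\<^bsub>BijGroup S\<^esub> (T h)) (b u) \<noteq> b u"
    have eq: "h \<otimes>\<^bsub>H\<^esub> (inv\<^bsub>H\<^esub> h \<otimes>\<^bsub>H\<^esub> u) = u"
      using h u by (simp flip: H.m_assoc)
    have "f (b (inv\<^bsub>H\<^esub> h \<otimes>\<^bsub>H\<^esub> u)) \<noteq> b (inv\<^bsub>H\<^esub> h \<otimes>\<^bsub>H\<^esub> u)"
      using ne *[OF u] Tb[of h "inv\<^bsub>H\<^esub> h \<otimes>\<^bsub>H\<^esub> u"] h u eq by auto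
    thus "u \<in> (\<lambda>u. h \<otimes>\<^bsub>H\<^esub> u) ` {u \<in> carrier H. f (b u) \<noteq> b u}"
      using h u eq by (intro image_eqI[of _ _ "inv\<^bsub>H\<^esub> h \<otimes>\<^bsub>H\<^esub> u"]) auto
  qed
  thus ?thesis using f(2) by (meson finite_imageI finite_subset)
qed

lemma hom_BijGroupI:
  assumes H: "group H"
    and ext: "\<And>h. h \<in> carrier H \<Longrightarrow> T h \<in> extensional S"
    and cl: "\<And>h x. h \<in> carrier H \<Longrightarrow> x \<in> S \<Longrightarrow> T h x \<in> S"
    and one: "\<And>x. x \<in> S \<Longrightarrow> T \<one>\<^bsub>H\<^esub> x = x"
    and mult: "\<And>h k x. h \<in> carrier H \<Longrightarrow> k \<in> carrier H \<Longrightarrow> x \<in> S \<Longrightarrow> T (h \<otimes>\<^bsub>H\<^esub> k) x = T h (T k x)"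
  shows "T \<in> hom H (BijGroup S)"
proof -
  interpret H: group H by (rule H)
  have B: "T h \<in> Bij S" if h: "h \<in> carrier H" for h
    unfolding Bij_def
  proof (intro IntI CollectI ext[OF h])
    show "bij_betw (T h) S S"
      using h cl by (intro bij_betw_byWitness[where f' = "T (inv\<^bsub>H\<^esub> h)"]) (auto simp: one simp flip: mult)
  qed
  have "T (h \<otimes>\<^bsub>H\<^esub> k) = compose S (T h) (T k)" if "h \<in> carrier H" "k \<in> carrier H" for h k
    using that ext[of "h \<otimes>\<^bsub>H\<^esub> k"]
    by (auto simp: compose_def fun_eq_iff mult extensional_def)
  thus ?thesis using B by (auto simp: hom_def BijGroup_simps)
qed

lemma group_Shuffler:
  assumes H: "group H"
  shows "group (Shuffler H)"
proof -
  interpret H: group H by (rule H)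
  let ?S = "carrier H" and ?N = "{\<sigma> \<in> Bij (carrier H). finite {x \<in> carrier H. \<sigma> x \<noteq> x}}"
  let ?T = "\<lambda>h. \<lambda>x \<in> carrier H. h \<otimes>\<^bsub>H\<^esub> x"
  have T: "?T \<in> hom H (BijGroup ?S)"
    by (rule hom_BijGroupI[OF H]) (auto simp: H.m_assoc)
  interpret T: group_hom H "BijGroup ?S" ?T
    by (simp only: group_hom_def group_hom_axioms_def H T group_BijGroup simp_thms)
  have TB: "?T h \<in> Bij ?S" if "h \<in> carrier H" for h
    using T.hom_closed[OF that] by (simp add: BijGroup_simps)
  have conj: "FSym_action H h \<sigma> = ?T h \<otimes>\<^bsub>BijGroup ?S\<^esub> \<sigma> \<otimes>\<^bsub>BijGroup ?S\<^esub> inv\<^bsub>BijGroup ?S\<^esub> (?T h)"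
    if "h \<in> ?S" "\<sigma> \<in> ?N" for h \<sigma>
  proof -
    have i: "inv\<^bsub>BijGroup ?S\<^esub> (?T h) = ?T (inv\<^bsub>H\<^esub> h)"
      using T.hom_inv[OF that(1)] by simp
    have "\<sigma> \<in> Bij ?S" using that by simp
    moreover have "?T (inv\<^bsub>H\<^esub> h) \<in> Bij ?S" using that by (simp del: T.hom_inv add: TB)
    ultimately show ?thesis
      unfolding i using that TB[OF that(1)] Bij_imp_funcset[OF \<open>\<sigma> \<in> Bij ?S\<close>]
      by (simp add: BijGroup_simps(2) compose_Bij del: T.hom_inv)
        (auto simp: FSym_action_def compose_def fun_eq_iff Pi_iff simp del: T.hom_inv)
  qed
  show ?thesis unfolding Shuffler_def FSym_def
  proof (rule group_semidirect_conjugation[OF group_BijGroup H _ T _ conj])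
    show "subgroup ?N (BijGroup ?S)"
      using subgroup_finite_support[of "\<lambda>x. x" ?S ?S] by simp
    show "FSym_action H h \<sigma> \<in> ?N" if "h \<in> ?S" "\<sigma> \<in> ?N" for h \<sigma>
    proof -
      have "?T h \<otimes>\<^bsub>BijGroup ?S\<^esub> \<sigma> \<otimes>\<^bsub>BijGroup ?S\<^esub> inv\<^bsub>BijGroup ?S\<^esub> (?T h) \<in> carrier (BijGroup ?S)"
        using that T.hom_closed[OF that(1)]
        by (intro T.H.m_closed T.H.inv_closed) (auto simp: BijGroup_simps(1))
      moreover have "finite {x \<in> ?S. (?T h \<otimes>\<^bsub>BijGroup ?S\<^esub> \<sigma> \<otimes>\<^bsub>BijGroup ?S\<^esub> inv\<^bsub>BijGroup ?S\<^esub> (?T h)) x \<noteq> x}"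
        using finite_support_conjugation[OF H _ T, of "\<lambda>x. x" h \<sigma>] that by auto
      ultimately show ?thesis unfolding conj[OF that] by (simp add: BijGroup_simps(1))
    qed
  qed assumption+
qed

lemma basis_vec_in_free_space:
  assumes "field K" and "u \<in> S"
  shows "basis_vec K u \<in> carrier (free_space K S)"
proof -
  interpret field K by (rule assms(1))
  have "{x. basis_vec K u x \<noteq> \<zero>\<^bsub>K\<^esub>} \<subseteq> {u}" by (auto simp: basis_vec_def)
  thus ?thesis using assms(2)
    by (auto simp: free_space_def basis_vec_def intro: finite_subset)
qed

lemma vectorspace_free_space:
  assumes "field K"
  shows "vectorspace K (free_space K S)"
proof -
  interpret field K by (rule assms)
  have fin: "finite {x. v x \<oplus>\<^bsub>K\<^esub> w x \<noteq> \<zero>\<^bsub>K\<^esub>}"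
    if "finite {x. v x \<noteq> \<zero>\<^bsub>K\<^esub>}" "finite {x. w x \<noteq> \<zero>\<^bsub>K\<^esub>}" for v w :: "'c \<Rightarrow> 'a"
    by (rule finite_subset[OF _ finite_UnI[OF that]]) auto
  have fin': "finite {x. c \<otimes>\<^bsub>K\<^esub> v x \<noteq> \<zero>\<^bsub>K\<^esub>}"
    if "c \<in> carrier K" "finite {x. v x \<noteq> \<zero>\<^bsub>K\<^esub>}" for c and v :: "'c \<Rightarrow> 'a"
    by (rule finite_subset[OF _ that(2)]) (use that(1) in auto)
  have ab: "abelian_group (free_space K S)"
  proof (rule abelian_groupI)
    fix v assume v: "v \<in> carrier (free_space K S)"
    have "(\<lambda>x. \<ominus>\<^bsub>K\<^esub> v x) \<in> carrier (free_space K S)"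
      using v by (auto simp: free_space_def image_subset_iff add.inv_eq_1_iff)
    moreover have "(\<lambda>x. \<ominus>\<^bsub>K\<^esub> v x) \<oplus>\<^bsub>free_space K S\<^esub> v = \<zero>\<^bsub>free_space K S\<^esub>"
      using v by (auto simp: free_space_def image_subset_iff l_neg)
    ultimately show "\<exists>w\<in>carrier (free_space K S). w \<oplus>\<^bsub>free_space K S\<^esub> v = \<zero>\<^bsub>free_space K S\<^esub>"
      by blast
  next
    fix v w assume v: "v \<in> carrier (free_space K S)" and w: "w \<in> carrier (free_space K S)"
    have "{x. v x \<oplus>\<^bsub>K\<^esub> w x \<noteq> \<zero>\<^bsub>K\<^esub>} \<subseteq> {x. v x \<noteq> \<zero>\<^bsub>K\<^esub>} \<union> {x. w x \<noteq> \<zero>\<^bsub>K\<^esub>}" by auto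
    thus "v \<oplus>\<^bsub>free_space K S\<^esub> w \<in> carrier (free_space K S)"
      using v w by (auto simp: free_space_def image_subset_iff fin)
  qed (auto simp: free_space_def image_subset_iff fun_eq_iff a_ac)
  have "module K (free_space K S)"
  proof (rule moduleI[OF is_cring ab])
    fix c v assume c: "c \<in> carrier K" and v: "v \<in> carrier (free_space K S)"
    have "{x. c \<otimes>\<^bsub>K\<^esub> v x \<noteq> \<zero>\<^bsub>K\<^esub>} \<subseteq> {x. v x \<noteq> \<zero>\<^bsub>K\<^esub>}" using c by auto
    thus "c \<odot>\<^bsub>free_space K S\<^esub> v \<in> carrier (free_space K S)"
      using c v by (auto simp: free_space_def image_subset_iff fin')
  qed (auto simp: free_space_def image_subset_iff fun_eq_iff m_assoc l_distr r_distr)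
  thus ?thesis by (simp add: vectorspace_def assms)
qed

lemma translation_hom:
  assumes H: "group H" and K: "field K"
  shows "translation K H \<in> hom H (BijGroup (carrier (free_space K (carrier H))))"
proof (rule hom_BijGroupI[OF H])
  interpret H: group H by (rule H)
  interpret K: field K by (rule K)
  let ?V = "carrier (free_space K (carrier H))"
  show cl: "translation K H h v \<in> ?V" if h: "h \<in> carrier H" and v: "v \<in> ?V" for h v
  proof -
    let ?w = "\<lambda>x. if x \<in> carrier H then v (inv\<^bsub>H\<^esub> h \<otimes>\<^bsub>H\<^esub> x) else \<zero>\<^bsub>K\<^esub>"
    have "{x. ?w x \<noteq> \<zero>\<^bsub>K\<^esub>} \<subseteq> (\<lambda>x. h \<otimes>\<^bsub>H\<^esub> x) ` {x. v x \<noteq> \<zero>\<^bsub>K\<^esub>}"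
    proof
      fix x assume x: "x \<in> {x. ?w x \<noteq> \<zero>\<^bsub>K\<^esub>}"
      hence "x \<in> carrier H" by (auto split: if_splits)
      thus "x \<in> (\<lambda>x. h \<otimes>\<^bsub>H\<^esub> x) ` {x. v x \<noteq> \<zero>\<^bsub>K\<^esub>}"
        using h x by (intro image_eqI[of _ _ "inv\<^bsub>H\<^esub> h \<otimes>\<^bsub>H\<^esub> x"]) (auto simp flip: H.m_assoc)
    qed
    moreover have "finite {x. v x \<noteq> \<zero>\<^bsub>K\<^esub>}" using v by (simp add: free_space_def)
    ultimately have "finite {x. ?w x \<noteq> \<zero>\<^bsub>K\<^esub>}"
      using finite_subset by blast
    moreover have "\<forall>x. ?w x \<in> carrier K" using v by (auto simp: free_space_def image_subset_iff)
    ultimately have "?w \<in> ?V" by (auto simp: free_space_def image_subset_iff split: if_splits)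
    thus ?thesis using v by (simp add: translation_def)
  qed
  show "translation K H \<one>\<^bsub>H\<^esub> v = v" if "v \<in> ?V" for v
  proof -
    have "v x = \<zero>\<^bsub>K\<^esub>" if "x \<notin> carrier H" for x
      using \<open>v \<in> ?V\<close> that by (auto simp: free_space_def)
    thus ?thesis using that by (auto simp: translation_def fun_eq_iff)
  qed
  show "translation K H (h \<otimes>\<^bsub>H\<^esub> k) v = translation K H h (translation K H k v)"
    if "h \<in> carrier H" "k \<in> carrier H" "v \<in> ?V" for h k v
    using that cl[OF that(2,3)]
    by (auto simp: translation_def fun_eq_iff H.inv_mult_group H.m_assoc)
qed (auto simp: translation_def)

lemma translation_linear:
  assumes H: "group H" and K: "field K" and h: "h \<in> carrier H"
  shows "translation K H h \<in> module_hom K (free_space K (carrier H)) (free_space K (carrier H))"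
proof -
  interpret K: field K by (rule K)
  interpret V: vectorspace K "free_space K (carrier H)" by (rule vectorspace_free_space[OF K])
  let ?V = "free_space K (carrier H)"
  have "translation K H h \<in> Bij (carrier ?V)"
    using hom_in_carrier[OF translation_hom[OF H K] h] by (simp add: BijGroup_simps)
  hence "translation K H h \<in> carrier ?V \<rightarrow> carrier ?V" by (rule Bij_imp_funcset)
  moreover have "translation K H h (v \<oplus>\<^bsub>?V\<^esub> w) = translation K H h v \<oplus>\<^bsub>?V\<^esub> translation K H h w"
    if "v \<in> carrier ?V" "w \<in> carrier ?V" for v w
    using that V.M.add.m_closed[OF that] by (auto simp: translation_def fun_eq_iff) (auto simp: free_space_def)
  moreover have "translation K H h (c \<odot>\<^bsub>?V\<^esub> v) = c \<odot>\<^bsub>?V\<^esub> translation K H h v"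
    if "c \<in> carrier K" "v \<in> carrier ?V" for c v
    using that V.smult_closed[OF that] by (auto simp: translation_def fun_eq_iff) (auto simp: free_space_def)
  ultimately show ?thesis by (auto simp: module_hom_def)
qed

lemma translation_basis_vec:
  assumes H: "group H" and K: "field K" and h: "h \<in> carrier H" and u: "u \<in> carrier H"
  shows "translation K H h (basis_vec K u) = basis_vec K (h \<otimes>\<^bsub>H\<^esub> u)"
proof -
  interpret H: group H by (rule H)
  have "inv\<^bsub>H\<^esub> h \<otimes>\<^bsub>H\<^esub> x = u \<longleftrightarrow> x = h \<otimes>\<^bsub>H\<^esub> u" if "x \<in> carrier H" for x
    using h u that by (auto simp flip: H.m_assoc)
  thus ?thesis
    using basis_vec_in_free_space[OF K u] h u by (auto simp: translation_def basis_vec_def fun_eq_iff)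
qed

lemma subgroup_linear_Bij:
  assumes K: "field K"
  shows "subgroup (Bij (carrier (free_space K S)) \<inter> module_hom K (free_space K S) (free_space K S))
    (BijGroup (carrier (free_space K S)))"
proof -
  let ?V = "free_space K S"
  interpret V: vectorspace K ?V by (rule vectorspace_free_space[OF K])
  note [simp] = V.M.add.m_closed V.smult_closed
  show ?thesis
  proof (rule subgroup.intro)
    fix f g
    assume f: "f \<in> Bij (carrier ?V) \<inter> module_hom K ?V ?V" and g: "g \<in> Bij (carrier ?V) \<inter> module_hom K ?V ?V"
    thus "f \<otimes>\<^bsub>BijGroup (carrier ?V)\<^esub> g \<in> Bij (carrier ?V) \<inter> module_hom K ?V ?V"
      by (auto simp: BijGroup_simps compose_Bij) (auto simp: module_hom_def compose_def Pi_iff)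
  next
    show "\<one>\<^bsub>BijGroup (carrier ?V)\<^esub> \<in> Bij (carrier ?V) \<inter> module_hom K ?V ?V"
      by (auto simp: BijGroup_simps id_Bij) (auto simp: module_hom_def)
  next
    fix f assume f: "f \<in> Bij (carrier ?V) \<inter> module_hom K ?V ?V"
    let ?g = "inv_into (carrier ?V) f"
    have fB: "f \<in> Bij (carrier ?V)" using f by simp
    have g: "?g x \<in> carrier ?V" "f (?g x) = x" if "x \<in> carrier ?V" for x
      using that fB by (auto simp: Bij_def bij_betw_def inv_into_into f_inv_into_f)
    have gf: "?g (f x) = x" if "x \<in> carrier ?V" for x
      using that fB by (auto simp: Bij_def bij_betw_def)
    have "?g (v \<oplus>\<^bsub>?V\<^esub> w) = ?g v \<oplus>\<^bsub>?V\<^esub> ?g w" if "v \<in> carrier ?V" "w \<in> carrier ?V" for v w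
    proof -
      have "f (?g v \<oplus>\<^bsub>?V\<^esub> ?g w) = v \<oplus>\<^bsub>?V\<^esub> w"
        using f that g by (auto simp: module_hom_def)
      thus ?thesis using gf[of "?g v \<oplus>\<^bsub>?V\<^esub> ?g w"] that g by simp
    qed
    moreover have "?g (c \<odot>\<^bsub>?V\<^esub> v) = c \<odot>\<^bsub>?V\<^esub> ?g v" if "c \<in> carrier K" "v \<in> carrier ?V" for c v
    proof -
      have "f (c \<odot>\<^bsub>?V\<^esub> ?g v) = c \<odot>\<^bsub>?V\<^esub> v"
        using f that g by (auto simp: module_hom_def)
      thus ?thesis using gf[of "c \<odot>\<^bsub>?V\<^esub> ?g v"] that g by simp
    qed
    ultimately have "(\<lambda>x \<in> carrier ?V. ?g x) \<in> module_hom K ?V ?V"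
      using g by (auto simp: module_hom_def)
    thus "inv\<^bsub>BijGroup (carrier ?V)\<^esub> f \<in> Bij (carrier ?V) \<inter> module_hom K ?V ?V"
      using fB by (simp add: inv_BijGroup restrict_inv_into_Bij del: restrict_apply)
  qed (auto simp: BijGroup_simps)
qed

lemma group_Cloner:
  assumes H: "group H" and K: "field K"
  shows "group (Cloner K H)"
proof -
  let ?V = "free_space K (carrier H)"
  let ?S = "carrier ?V"
  let ?L = "Bij ?S \<inter> module_hom K ?V ?V"
  let ?F = "{f \<in> Bij ?S. finite {u \<in> carrier H. f (basis_vec K u) \<noteq> basis_vec K u}}"
  let ?N = "{f \<in> Bij ?S. f \<in> module_hom K ?V ?V \<and>
    finite {u \<in> carrier H. f (basis_vec K u) \<noteq> basis_vec K u}}"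
  have NLF: "?N = ?L \<inter> ?F" by auto
  note T = translation_hom[OF H K]
  interpret B: group "BijGroup ?S" by (rule group_BijGroup)
  interpret L: subgroup ?L "BijGroup ?S" by (rule subgroup_linear_Bij[OF K])
  have b: "basis_vec K ` carrier H \<subseteq> ?S" using basis_vec_in_free_space[OF K] by auto
  show ?thesis unfolding Cloner_def FGL_def
  proof (rule group_semidirect_conjugation[OF group_BijGroup H _ T])
    show "subgroup ?N (BijGroup ?S)" unfolding NLF
      by (intro B.subgroups_Inter_pair subgroup_linear_Bij[OF K] subgroup_finite_support[OF b])
    fix h f assume h: "h \<in> carrier H" and f: "f \<in> ?N"
    show c: "FGL_action K H h f = translation K H h \<otimes>\<^bsub>BijGroup ?S\<^esub> f \<otimes>\<^bsub>BijGroup ?S\<^esub>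
        inv\<^bsub>BijGroup ?S\<^esub> translation K H h"
      by (simp add: FGL_action_def Let_def)
    have "translation K H h \<in> ?L"
      using hom_in_carrier[OF T h] translation_linear[OF H K h] by (simp add: BijGroup_simps)
    hence "FGL_action K H h f \<in> ?L"
      unfolding c using f by (intro L.m_closed L.m_inv_closed) auto
    moreover have "finite {u \<in> carrier H. FGL_action K H h f (basis_vec K u) \<noteq> basis_vec K u}"
      unfolding c using f
      by (intro finite_support_conjugation[OF H b T translation_basis_vec[OF H K] h]) auto
    ultimately show "FGL_action K H h f \<in> ?N" by auto
  qed
qed

end

theory Submission
  imports Defs
begin

text \<open>Both groups have the form \<open>N \<rtimes> H\<close>, where every element of \<open>N\<close> lives on a finite part of
  \<open>H\<close>: for \<open>X \<subseteq> H\<close> there is a subgroup \<open>P X\<close> of \<open>N\<close> (the permutations supported in \<open>X\<close>,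
  respectively the linear automorphisms acting on the span of \<open>X\<close> only). These subgroups grow
  with \<open>X\<close>, are finite for finite \<open>X\<close>, exhaust \<open>N\<close>, and \<open>g \<in> H\<close> carries \<open>P X\<close> onto \<open>P (g X)\<close>.
  The locale \<open>localized_semidirect\<close> records exactly this, and from a Foelner tiling sequence
  \<open>F\<close> of \<open>H\<close> it yields the sequence \<open>P (F n) \<times> F n\<close> of \<open>N \<rtimes> H\<close>.

  It is a Foelner sequence (\<open>folner_lift\<close>): since
  \<open>(\<sigma>, h) (\<tau>, k) = (\<sigma> \<cdot> (h \<cdot> \<tau>), h k)\<close>, with \<open>h \<cdot> \<tau> \<in> P (h X)\<close> whenever \<open>\<tau> \<in> P X\<close>, right
  multiplication by \<open>(\<tau>, k)\<close> can leave \<open>P (F n) \<times> F n\<close> only if \<open>h s\<close> leaves \<open>F n\<close> for one of the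
  finitely many \<open>s \<in> X \<union> {k}\<close>. The proportion of such \<open>h\<close> tends to zero.

  It satisfies the tiling condition (\<open>tiling_lift\<close>): a translate by \<open>(a, g)\<close> is the product of the
  coset \<open>a P (g F n)\<close> with \<open>g F n\<close>. If \<open>g F n\<close> is one of the tiles of \<open>F (n + 1)\<close>, then
  \<open>P (g F n)\<close> is a subgroup of \<open>P (F (n + 1))\<close>, so its cosets partition \<open>P (F (n + 1))\<close>; letting \<open>g\<close>
  range over the old tile centres, and \<open>a\<close> over coset representatives that depend on \<open>g\<close>, gives the
  new tiles.

  The set with index zero need not be trivial: over a field with more than two elements
  \<open>P {1}\<close> contains the nontrivial scalings of one basis vector. But a first set may always be
  replaced by the trivial one (\<open>folner_tiling_sequence_normalize\<close>), because every finite set is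
  tiled by its points.\<close>

section \<open>The first set of a tiling sequence\<close>

lemma folner_tiling_sequence_normalize:
  assumes "group G" and F: "right_folner_sequence G F" and T: "tiling_condition G F"
  shows "folner_tiling_sequence G (F(0 := {\<one>\<^bsub>G\<^esub>}))"
proof -
  interpret group G by fact
  let ?F = "F(0 := {\<one>\<^bsub>G\<^esub>})"
  have fin: "finite (F n)" "F n \<noteq> {}" "F n \<subseteq> carrier G" for n
    using F by (auto simp: right_folner_sequence_def)
  have "(\<lambda>n. real (card ((?F n #>\<^bsub>G\<^esub> g) - ?F n)) / real (card (?F n))) \<longlonglongrightarrow> 0"
    if "g \<in> carrier G" for g
  proof (rule Lim_transform_eventually)
    show "(\<lambda>n. real (card ((F n #>\<^bsub>G\<^esub> g) - F n)) / real (card (F n))) \<longlonglongrightarrow> 0"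
      using F that by (auto simp: right_folner_sequence_def)
    show "\<forall>\<^sub>F n in sequentially. real (card ((F n #>\<^bsub>G\<^esub> g) - F n)) / real (card (F n)) =
        real (card ((?F n #>\<^bsub>G\<^esub> g) - ?F n)) / real (card (?F n))"
      using eventually_gt_at_top[of "0::nat"] by eventually_elim simp
  qed
  moreover have "\<exists>\<Sigma>. finite \<Sigma> \<and> \<Sigma> \<subseteq> carrier G \<and>
      disjoint_family_on (\<lambda>g. g <#\<^bsub>G\<^esub> ?F n) \<Sigma> \<and> ?F (Suc n) = \<Sigma> <#>\<^bsub>G\<^esub> ?F n" for n
  proof (cases n)
    case 0
    have one: "g \<otimes>\<^bsub>G\<^esub> \<one>\<^bsub>G\<^esub> = g" if "g \<in> F 1" for g
      using that fin(3)[of 1] by (simp add: subset_iff)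
    have "disjoint_family_on (\<lambda>g. g <#\<^bsub>G\<^esub> {\<one>\<^bsub>G\<^esub>}) (F 1)"
      by (auto simp: disjoint_family_on_def l_coset_def one[simplified])

    moreover have "F 1 <#>\<^bsub>G\<^esub> {\<one>\<^bsub>G\<^esub>} = F 1"
      by (auto simp: set_mult_def one[simplified])
    ultimately show ?thesis
      using fin[of 1] 0 by (intro exI[of _ "F 1"]) auto
  next
    case (Suc m)
    thus ?thesis using T by (simp add: tiling_condition_def)
  qed
  ultimately show ?thesis
    using fin by (simp add: folner_tiling_sequence_def right_folner_sequence_def tiling_condition_def)
qed

section \<open>Coset representatives of nested finite subgroups\<close>

lemma (in group) left_transversal_exists:
  assumes A: "subgroup A G" and B: "subgroup B G" and AB: "A \<subseteq> B" and fin: "finite B"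
  shows "\<exists>T. finite T \<and> T \<subseteq> B \<and> disjoint_family_on (\<lambda>t. t <# A) T \<and> (\<Union>t\<in>T. t <# A) = B"
proof -
  let ?r = "\<lambda>C. SOME b. b \<in> C" and ?Q = "(\<lambda>b. b <# A) ` B"
  have B_carrier: "b \<in> carrier G" if "b \<in> B" for b
    using that subgroup.mem_carrier[OF B] by blast
  have mem: "b \<in> b <# A" if "b \<in> B" for b
    using subgroup.one_closed[OF A] B_carrier[OF that] by (force simp: l_coset_def)
  have sub: "b <# A \<subseteq> B" if "b \<in> B" for b
    using AB that subgroup.m_closed[OF B] by (auto simp: l_coset_def)
  have r: "?r (b <# A) \<in> b <# A" if "b \<in> B" for b
    using mem[OF that] by (rule someI)
  have coset_r: "?r (b <# A) <# A = b <# A" if "b \<in> B" for b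
    using l_repr_independence[OF r[OF that] B_carrier[OF that] A] by simp
  have "disjoint_family_on (\<lambda>t. t <# A) (?r ` ?Q)"
  proof -
    have False if b: "b \<in> B" "c \<in> B" and ne: "b <# A \<noteq> c <# A" and x: "x \<in> b <# A" "x \<in> c <# A" for b c x
      using l_repr_independence[OF x(1) B_carrier[OF b(1)] A]
        l_repr_independence[OF x(2) B_carrier[OF b(2)] A] ne by simp
    thus ?thesis
      by (fastforce simp: disjoint_family_on_def coset_r)
  qed
  moreover have "(\<Union>t\<in>?r ` ?Q. t <# A) = B"
    using mem sub by (auto simp: coset_r)
  moreover have "?r ` ?Q \<subseteq> B" using r sub by blast
  moreover have "finite (?r ` ?Q)" using fin by blast
  ultimately show ?thesis by blast
qed

section \<open>Semidirect products with a localized normal factor\<close>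

text \<open>\<open>P X\<close> is to be thought of as the subgroup of those elements of \<open>N\<close> that live on \<open>X\<close>. The
  group axioms of the semidirect product are assumed in place of those of the action: they
  imply the latter (\<open>action_one\<close>, \<open>action_comp\<close>).\<close>

locale localized_semidirect =
  N: group N + H: group H + G: group "semidirect N H \<phi>"
  for N :: "('n, 'x) monoid_scheme" and H :: "('h, 'y) monoid_scheme" and \<phi> :: "'h \<Rightarrow> 'n \<Rightarrow> 'n" +
  fixes P :: "'h set \<Rightarrow> 'n set"
  assumes P_subgroup: "X \<subseteq> carrier H \<Longrightarrow> subgroup (P X) N"
    and P_finite: "X \<subseteq> carrier H \<Longrightarrow> finite X \<Longrightarrow> finite (P X)"
    and P_mono: "X \<subseteq> Y \<Longrightarrow> Y \<subseteq> carrier H \<Longrightarrow> P X \<subseteq> P Y"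
    and P_action: "g \<in> carrier H \<Longrightarrow> X \<subseteq> carrier H \<Longrightarrow> a \<in> P X \<Longrightarrow> \<phi> g a \<in> P (g <#\<^bsub>H\<^esub> X)"
    and P_exhausts: "a \<in> carrier N \<Longrightarrow> \<exists>X. finite X \<and> X \<subseteq> carrier H \<and> a \<in> P X"
begin

abbreviation "G \<equiv> semidirect N H \<phi>"

lemma carrier_G: "carrier G = carrier N \<times> carrier H"
  by (simp add: semidirect_def)

lemma mult_G: "(a, h) \<otimes>\<^bsub>G\<^esub> (b, k) = (a \<otimes>\<^bsub>N\<^esub> \<phi> h b, h \<otimes>\<^bsub>H\<^esub> k)"
  by (simp add: semidirect_def)

lemma action_closed: "g \<in> carrier H \<Longrightarrow> a \<in> carrier N \<Longrightarrow> \<phi> g a \<in> carrier N"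
  by (metis P_action P_exhausts P_subgroup H.l_coset_subset_G subgroup.mem_carrier)

lemma action_one: "a \<in> carrier N \<Longrightarrow> \<phi> \<one>\<^bsub>H\<^esub> a = a"
  using G.l_one[of "(a, \<one>\<^bsub>H\<^esub>)"] action_closed[of "\<one>\<^bsub>H\<^esub>" a] by (simp add: semidirect_def)

lemma action_comp:
  assumes "g \<in> carrier H" "h \<in> carrier H" "a \<in> carrier N"
  shows "\<phi> (g \<otimes>\<^bsub>H\<^esub> h) a = \<phi> g (\<phi> h a)"
proof -
  have "\<phi> g \<one>\<^bsub>N\<^esub> = \<one>\<^bsub>N\<^esub>"
    using G.r_one[of "(\<one>\<^bsub>N\<^esub>, g)"] assms action_closed[of g "\<one>\<^bsub>N\<^esub>"] by (simp add: semidirect_def)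
  thus ?thesis
    using G.m_assoc[of "(\<one>\<^bsub>N\<^esub>, g)" "(\<one>\<^bsub>N\<^esub>, h)" "(a, \<one>\<^bsub>H\<^esub>)"] assms
    by (simp add: carrier_G mult_G action_closed)
qed

text \<open>The inclusion assumed for \<open>g\<close> becomes an equality by applying it to the inverse of \<open>g\<close> as well.\<close>

lemma P_translate:
  assumes g: "g \<in> carrier H" and X: "X \<subseteq> carrier H"
  shows "\<phi> g ` P X = P (g <#\<^bsub>H\<^esub> X)"
proof
  show "\<phi> g ` P X \<subseteq> P (g <#\<^bsub>H\<^esub> X)" using assms P_action by blast
  show "P (g <#\<^bsub>H\<^esub> X) \<subseteq> \<phi> g ` P X"
  proof
    fix a assume a: "a \<in> P (g <#\<^bsub>H\<^esub> X)"
    have gX: "g <#\<^bsub>H\<^esub> X \<subseteq> carrier H" using assms by (simp add: H.l_coset_subset_G)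
    have aN: "a \<in> carrier N" using subgroup.mem_carrier[OF P_subgroup[OF gX] a] .
    have "inv\<^bsub>H\<^esub> g <#\<^bsub>H\<^esub> (g <#\<^bsub>H\<^esub> X) = X"
      using assms by (simp add: H.lcos_m_assoc H.lcos_mult_one)
    hence "\<phi> (inv\<^bsub>H\<^esub> g) a \<in> P X"
      using P_action[OF _ gX a, of "inv\<^bsub>H\<^esub> g"] g by simp
    moreover have "\<phi> g (\<phi> (inv\<^bsub>H\<^esub> g) a) = a"
      using g aN by (simp flip: action_comp add: action_one)
    ultimately show "a \<in> \<phi> g ` P X" by force
  qed
qed

text \<open>This product form is what makes tiles of \<open>H\<close> lift: the two factors can be tiled one after the
  other.\<close>

lemma l_coset_lift:
  assumes g: "g \<in> carrier H" and X: "X \<subseteq> carrier H"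
  shows "(a, g) <#\<^bsub>G\<^esub> (P X \<times> X) = (a <#\<^bsub>N\<^esub> P (g <#\<^bsub>H\<^esub> X)) \<times> (g <#\<^bsub>H\<^esub> X)"
  unfolding P_translate[OF assms, symmetric] by (auto simp: l_coset_def mult_G)

text \<open>The new centres are the pairs \<open>(a, g)\<close> with \<open>g\<close> an old centre and \<open>a\<close> a representative of a
  coset of \<open>P (g F n)\<close> in \<open>P (F (n + 1))\<close>. Two new tiles are disjoint in the second factor if
  their \<open>g\<close> differ, and in the first factor otherwise.\<close>

lemma tiling_lift:
  assumes F: "\<And>n. finite (F n)" "\<And>n. F n \<subseteq> carrier H" and T: "tiling_condition H F"
  shows "tiling_condition G (\<lambda>n. P (F n) \<times> F n)"
  unfolding tiling_condition_def
proof
  fix n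
  obtain S where S: "finite S" "S \<subseteq> carrier H"
      "disjoint_family_on (\<lambda>g. g <#\<^bsub>H\<^esub> F n) S" "F (Suc n) = S <#>\<^bsub>H\<^esub> F n"
    using T unfolding tiling_condition_def by blast
  have S_union: "F (Suc n) = (\<Union>g\<in>S. g <#\<^bsub>H\<^esub> F n)"
    using S(4) by (auto simp: set_mult_def l_coset_def)
  let ?P = "\<lambda>g. P (g <#\<^bsub>H\<^esub> F n)"
  have "\<exists>T. finite T \<and> T \<subseteq> P (F (Suc n)) \<and> disjoint_family_on (\<lambda>t. t <#\<^bsub>N\<^esub> ?P g) T \<and>
      (\<Union>t\<in>T. t <#\<^bsub>N\<^esub> ?P g) = P (F (Suc n))" if g: "g \<in> S" for g
  proof (rule N.left_transversal_exists)
    have "g \<in> carrier H" using g S(2) by blast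
    thus "subgroup (?P g) N" by (intro P_subgroup H.l_coset_subset_G F)
    show "?P g \<subseteq> P (F (Suc n))" using g by (intro P_mono F) (auto simp: S_union)
  qed (use F in \<open>blast intro: P_subgroup P_finite\<close>)+
  then obtain T where T: "\<And>g. g \<in> S \<Longrightarrow> finite (T g)" "\<And>g. g \<in> S \<Longrightarrow> T g \<subseteq> P (F (Suc n))"
      "\<And>g. g \<in> S \<Longrightarrow> disjoint_family_on (\<lambda>t. t <#\<^bsub>N\<^esub> ?P g) (T g)"
      "\<And>g. g \<in> S \<Longrightarrow> (\<Union>t\<in>T g. t <#\<^bsub>N\<^esub> ?P g) = P (F (Suc n))"
    by metis
  \<comment> \<open>The swap puts the representative, which depends on \<open>g\<close>, into the first component.\<close>
  define R where "R = prod.swap ` Sigma S T"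
  have R: "(a, g) \<in> R \<longleftrightarrow> g \<in> S \<and> a \<in> T g" for a g by (force simp: R_def)
  have tile: "(a, g) <#\<^bsub>G\<^esub> (P (F n) \<times> F n) = (a <#\<^bsub>N\<^esub> ?P g) \<times> (g <#\<^bsub>H\<^esub> F n)"
    if "(a, g) \<in> R" for a g
    using that S(2) F by (intro l_coset_lift) (auto simp: R)
  show "\<exists>\<Sigma>. finite \<Sigma> \<and> \<Sigma> \<subseteq> carrier G \<and>
      disjoint_family_on (\<lambda>g. g <#\<^bsub>G\<^esub> (P (F n) \<times> F n)) \<Sigma> \<and>
      P (F (Suc n)) \<times> F (Suc n) = \<Sigma> <#>\<^bsub>G\<^esub> (P (F n) \<times> F n)"
  proof (intro exI conjI)
    show "finite R" unfolding R_def using S(1) T(1) by auto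
    show "R \<subseteq> carrier G"
      using S(2) T(2) subgroup.subset[OF P_subgroup[OF F(2)]] by (fastforce simp: R carrier_G)
    show "disjoint_family_on (\<lambda>g. g <#\<^bsub>G\<^esub> (P (F n) \<times> F n)) R"
      unfolding disjoint_family_on_def
    proof (intro ballI impI)
      fix r r' assume r: "r \<in> R" "r' \<in> R" and ne: "r \<noteq> r'"
      obtain a g a' g' where eq: "r = (a, g)" "r' = (a', g')" by (cases r, cases r')
      show "(r <#\<^bsub>G\<^esub> (P (F n) \<times> F n)) \<inter> (r' <#\<^bsub>G\<^esub> (P (F n) \<times> F n)) = {}"
      proof (cases "g = g'")
        case True
        hence "(a <#\<^bsub>N\<^esub> ?P g) \<inter> (a' <#\<^bsub>N\<^esub> ?P g) = {}"
          using r ne eq T(3)[of g] by (auto simp: R disjoint_family_on_def)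
        thus ?thesis using r True by (auto simp: eq tile)
      next
        case False
        hence "(g <#\<^bsub>H\<^esub> F n) \<inter> (g' <#\<^bsub>H\<^esub> F n) = {}"
          using r eq S(3) by (auto simp: R disjoint_family_on_def)
        thus ?thesis using r by (auto simp: eq tile)
      qed
    qed
    have "R <#>\<^bsub>G\<^esub> (P (F n) \<times> F n) = (\<Union>r\<in>R. r <#\<^bsub>G\<^esub> (P (F n) \<times> F n))"
      by (auto simp: set_mult_def l_coset_def)
    also have "\<dots> = (\<Union>(a, g)\<in>R. (a <#\<^bsub>N\<^esub> ?P g) \<times> (g <#\<^bsub>H\<^esub> F n))"
      using tile by (intro SUP_cong) auto
    also have "\<dots> = (\<Union>g\<in>S. (\<Union>a\<in>T g. a <#\<^bsub>N\<^esub> ?P g) \<times> (g <#\<^bsub>H\<^esub> F n))"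
      by (force simp: R)
    also have "\<dots> = P (F (Suc n)) \<times> F (Suc n)"
      using T(4) by (auto simp: S_union)
    finally show "P (F (Suc n)) \<times> F (Suc n) = R <#>\<^bsub>G\<^esub> (P (F n) \<times> F n)" ..
  qed
qed

text \<open>The boundary of \<open>P A \<times> A\<close> under \<open>(\<tau>, k)\<close> is controlled by boundaries of \<open>A\<close> in \<open>H\<close>: a pair
  \<open>(\<sigma>, h)\<close> stays inside as soon as \<open>h k \<in> A\<close> and \<open>h X \<subseteq> A\<close>, because then \<open>h \<cdot> \<tau> \<in> P A\<close>, whatever
  \<open>\<sigma>\<close> is. The factor \<open>card (P A)\<close>, which may be huge, cancels in the Foelner quotient.\<close>

lemma card_lift_boundary:
  assumes A: "finite A" "A \<subseteq> carrier H" and X: "finite X" "X \<subseteq> carrier H"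
    and \<tau>: "\<tau> \<in> P X" and k: "k \<in> carrier H"
  shows "card (((P A \<times> A) #>\<^bsub>G\<^esub> (\<tau>, k)) - P A \<times> A) \<le>
    card (P A) * (\<Sum>s\<in>insert k X. card ((A #>\<^bsub>H\<^esub> s) - A))"
proof -
  define bad where "bad s = {h \<in> A. h \<otimes>\<^bsub>H\<^esub> s \<notin> A}" for s
  have bad: "card (bad s) \<le> card ((A #>\<^bsub>H\<^esub> s) - A)" if "s \<in> carrier H" for s
  proof (rule card_inj_on_le)
    show "inj_on (\<lambda>h. h \<otimes>\<^bsub>H\<^esub> s) (bad s)"
      using A that by (simp add: inj_on_def bad_def subset_iff)
    show "finite ((A #>\<^bsub>H\<^esub> s) - A)" using A by (simp add: r_coset_def)
  qed (auto simp: bad_def r_coset_def)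
  note PA = P_subgroup[OF A(2)]
  have fin: "finite (P A \<times> (\<Union>s\<in>insert k X. bad s))"
    using A X P_finite by (auto simp: bad_def)
  have "((P A \<times> A) #>\<^bsub>G\<^esub> (\<tau>, k)) - P A \<times> A \<subseteq>
      (\<lambda>x. x \<otimes>\<^bsub>G\<^esub> (\<tau>, k)) ` (P A \<times> (\<Union>s\<in>insert k X. bad s))"
  proof
    fix y assume y: "y \<in> ((P A \<times> A) #>\<^bsub>G\<^esub> (\<tau>, k)) - P A \<times> A"
    then obtain \<sigma> h where \<sigma>h: "\<sigma> \<in> P A" "h \<in> A" "y = (\<sigma>, h) \<otimes>\<^bsub>G\<^esub> (\<tau>, k)"
      by (auto simp: r_coset_def)
    have "h \<in> (\<Union>s\<in>insert k X. bad s)"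
    proof (rule ccontr)
      assume "h \<notin> (\<Union>s\<in>insert k X. bad s)"
      hence "h \<otimes>\<^bsub>H\<^esub> k \<in> A" and "h <#\<^bsub>H\<^esub> X \<subseteq> A"
        using \<sigma>h(2) by (auto simp: bad_def l_coset_def)
      hence "\<phi> h \<tau> \<in> P A"
        using P_action[OF _ X(2) \<tau>, of h] P_mono[OF _ A(2)] \<sigma>h(2) A(2) by blast
      hence "y \<in> P A \<times> A"
        using \<open>h \<otimes>\<^bsub>H\<^esub> k \<in> A\<close> \<sigma>h subgroup.m_closed[OF PA] by (simp add: mult_G)
      thus False using y by blast
    qed
    thus "y \<in> (\<lambda>x. x \<otimes>\<^bsub>G\<^esub> (\<tau>, k)) ` (P A \<times> (\<Union>s\<in>insert k X. bad s))"
      using \<sigma>h by blast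
  qed
  hence "card (((P A \<times> A) #>\<^bsub>G\<^esub> (\<tau>, k)) - P A \<times> A) \<le> card (P A \<times> (\<Union>s\<in>insert k X. bad s))"
    using surj_card_le[OF fin] by blast
  also have "\<dots> = card (P A) * card (\<Union>s\<in>insert k X. bad s)"
    by (rule card_cartesian_product)
  also have "\<dots> \<le> card (P A) * (\<Sum>s\<in>insert k X. card (bad s))"
    using X by (intro mult_left_mono card_UN_le) auto
  also have "\<dots> \<le> card (P A) * (\<Sum>s\<in>insert k X. card ((A #>\<^bsub>H\<^esub> s) - A))"
    using X k by (intro mult_left_mono sum_mono bad) auto
  finally show ?thesis .
qed

lemma folner_lift:
  assumes F: "right_folner_sequence H F"
  shows "right_folner_sequence G (\<lambda>n. P (F n) \<times> F n)"
proof -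
  have fin: "finite (F n)" "F n \<noteq> {}" "F n \<subseteq> carrier H" for n
    using F by (auto simp: right_folner_sequence_def)
  have P_ne: "finite (P (F n))" "P (F n) \<noteq> {}" "P (F n) \<subseteq> carrier N" for n
    using P_finite[OF fin(3,1)] P_subgroup[OF fin(3)] subgroup.one_closed subgroup.subset by blast+
  have "(\<lambda>n. real (card (((P (F n) \<times> F n) #>\<^bsub>G\<^esub> (\<tau>, k)) - P (F n) \<times> F n)) /
      real (card (P (F n) \<times> F n))) \<longlonglongrightarrow> 0" (is "?r \<longlonglongrightarrow> 0")
    if \<tau>: "\<tau> \<in> carrier N" and k: "k \<in> carrier H" for \<tau> k
  proof -
    obtain X where X: "finite X" "X \<subseteq> carrier H" "\<tau> \<in> P X"
      using P_exhausts[OF \<tau>] by blast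
    have lim: "(\<lambda>n. \<Sum>s\<in>insert k X. real (card ((F n #>\<^bsub>H\<^esub> s) - F n)) / real (card (F n))) \<longlonglongrightarrow> 0"
      using F X(2) k by (intro tendsto_null_sum) (auto simp: right_folner_sequence_def)
    have bound: "?r n \<le> (\<Sum>s\<in>insert k X. real (card ((F n #>\<^bsub>H\<^esub> s) - F n)) / real (card (F n)))" for n
    proof -
      let ?c = "\<Sum>s\<in>insert k X. card ((F n #>\<^bsub>H\<^esub> s) - F n)"
      have pos: "card (P (F n)) > 0" "card (F n) > 0"
        using P_ne fin by (simp_all add: card_gt_0_iff)
      have "?r n \<le> real (card (P (F n)) * ?c) / real (card (P (F n) \<times> F n))"
        using card_lift_boundary[OF fin(1,3) X k] by (intro divide_right_mono of_nat_mono) auto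
      also have "\<dots> = real ?c / real (card (F n))"
        using pos by (simp add: card_cartesian_product)
      finally show ?thesis by (simp add: sum_divide_distrib)
    qed
    show ?thesis
    proof (rule tendsto_sandwich[OF _ _ tendsto_const lim])
      show "\<forall>\<^sub>F n in sequentially. 0 \<le> ?r n" by simp
    qed (simp add: bound del: sum.insert)
  qed
  moreover have "P (F n) \<times> F n \<subseteq> carrier G" for n
    using fin(3) P_ne(3) unfolding carrier_G by (intro Sigma_mono)
  ultimately show ?thesis
    using fin P_ne by (auto simp: right_folner_sequence_def carrier_G)
qed

theorem folner_tiling_sequence_lift:
  assumes "folner_tiling_sequence H F"
  shows "\<exists>F'. folner_tiling_sequence G F'"
proof -
  have F: "right_folner_sequence H F" "tiling_condition H F"
    using assms by (auto simp: folner_tiling_sequence_def)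
  hence "finite (F n)" "F n \<subseteq> carrier H" for n
    by (auto simp: right_folner_sequence_def)
  thus ?thesis
    using folner_tiling_sequence_normalize[OF G.is_group folner_lift tiling_lift] F by blast
qed

end


section \<open>Subgroups of groups of bijections\<close>

lemma subgroup_FSym: "subgroup {\<sigma> \<in> Bij S. finite {x \<in> S. \<sigma> x \<noteq> x}} (BijGroup S)"
  using subgroup_finite_support[of "\<lambda>x. x" S S] by simp

lemma subgroup_FGL:
  assumes K: "field K"
  shows "subgroup {f \<in> Bij (carrier (free_space K S)).
      f \<in> module_hom K (free_space K S) (free_space K S) \<and>
      finite {u \<in> S. f (basis_vec K u) \<noteq> basis_vec K u}} (BijGroup (carrier (free_space K S)))"
    (is "subgroup ?N ?B")
proof -
  interpret B: group ?B by (rule group_BijGroup)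
  have "?N = (Bij (carrier (free_space K S)) \<inter> module_hom K (free_space K S) (free_space K S)) \<inter>
      {f \<in> Bij (carrier (free_space K S)). finite {u \<in> S. f (basis_vec K u) \<noteq> basis_vec K u}}"
    by auto
  thus ?thesis
    by (auto intro!: B.subgroups_Inter_pair subgroup_linear_Bij[OF K] subgroup_finite_support
        simp: basis_vec_in_free_space[OF K])
qed

text \<open>Pointwise characterisation of inverses, which spares the later proofs the restricted inverse
  functions.\<close>

lemma inv_subgroup_BijGroup:
  assumes C: "subgroup C (BijGroup S)" and f: "f \<in> C" and x: "x \<in> S"
  shows "(inv\<^bsub>BijGroup S\<lparr>carrier := C\<rparr>\<^esub> f) x \<in> S"
    and "f ((inv\<^bsub>BijGroup S\<lparr>carrier := C\<rparr>\<^esub> f) x) = x"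
    and "(inv\<^bsub>BijGroup S\<lparr>carrier := C\<rparr>\<^esub> f) (f x) = x"
proof -
  have B: "f \<in> Bij S" using subgroup.subset[OF C] f by (auto simp: BijGroup_simps)
  hence b: "bij_betw f S S" by (simp add: Bij_def)
  have "inv\<^bsub>BijGroup S\<lparr>carrier := C\<rparr>\<^esub> f = (\<lambda>x\<in>S. inv_into S f x)"
    using group.m_inv_consistent[OF group_BijGroup C f] inv_BijGroup[OF B] by simp
  thus "(inv\<^bsub>BijGroup S\<lparr>carrier := C\<rparr>\<^esub> f) x \<in> S"
    and "f ((inv\<^bsub>BijGroup S\<lparr>carrier := C\<rparr>\<^esub> f) x) = x"
    and "(inv\<^bsub>BijGroup S\<lparr>carrier := C\<rparr>\<^esub> f) (f x) = x"
    using b x by (auto simp: bij_betw_inv_into_left bij_betw_inv_into_right bij_betw_apply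
        bij_betwE[OF bij_betw_inv_into])
qed

section \<open>Finitary permutations\<close>

definition FSym_on :: "'a set \<Rightarrow> 'a set \<Rightarrow> ('a \<Rightarrow> 'a) set" where
  "FSym_on S X = {\<sigma> \<in> carrier (FSym S). \<forall>x \<in> S - X. \<sigma> x = x}"

lemma carrier_FSym: "carrier (FSym S) = {\<sigma> \<in> Bij S. finite {x \<in> S. \<sigma> x \<noteq> x}}"
  by (simp add: FSym_def)

lemma group_FSym: "group (FSym S)"
  unfolding FSym_def by (rule subgroup.subgroup_is_group[OF subgroup_FSym group_BijGroup])

lemma subgroup_FSym_on: "subgroup (FSym_on S X) (FSym S)"
proof -
  interpret group "FSym S" by (rule group_FSym)
  show ?thesis
  proof (rule subgroupI)
    have "\<one>\<^bsub>FSym S\<^esub> \<in> FSym_on S X"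
      using one_closed by (auto simp: FSym_on_def) (simp add: FSym_def BijGroup_simps)
    thus "FSym_on S X \<noteq> {}" by blast
  next
    fix \<sigma> assume \<sigma>: "\<sigma> \<in> FSym_on S X"
    hence c: "\<sigma> \<in> carrier (FSym S)" by (simp add: FSym_on_def)
    have "(inv\<^bsub>FSym S\<^esub> \<sigma>) x = x" if "x \<in> S - X" for x
    proof -
      have "(inv\<^bsub>FSym S\<^esub> \<sigma>) (\<sigma> x) = x"
        using that c inv_subgroup_BijGroup(3)[OF subgroup_FSym, of \<sigma> S x]
        by (simp add: FSym_def)
      moreover have "\<sigma> x = x" using \<sigma> that by (auto simp: FSym_on_def)
      ultimately show ?thesis by simp
    qed
    thus "inv\<^bsub>FSym S\<^esub> \<sigma> \<in> FSym_on S X" using c by (auto simp: FSym_on_def)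
  next
    fix \<sigma> \<tau> assume "\<sigma> \<in> FSym_on S X" "\<tau> \<in> FSym_on S X"
    moreover from this have "\<sigma> \<otimes>\<^bsub>FSym S\<^esub> \<tau> = compose S \<sigma> \<tau>"
      by (simp add: FSym_on_def FSym_def BijGroup_simps)
    ultimately show "\<sigma> \<otimes>\<^bsub>FSym S\<^esub> \<tau> \<in> FSym_on S X"
      using m_closed[of \<sigma> \<tau>] by (auto simp: FSym_on_def compose_def)
  qed (auto simp: FSym_on_def)
qed

text \<open>A permutation that is the identity off \<open>X\<close> preserves \<open>X\<close> by injectivity, and is determined by
  its restriction to \<open>X\<close>.\<close>

lemma finite_FSym_on:
  assumes "X \<subseteq> S" "finite X"
  shows "finite (FSym_on S X)"
proof (rule inj_on_finite)
  show "finite (X \<rightarrow>\<^sub>E X)" using assms by (simp add: finite_PiE)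
  show "inj_on (\<lambda>\<sigma>. restrict \<sigma> X) (FSym_on S X)"
  proof (rule inj_onI)
    fix \<sigma> \<tau> assume st: "\<sigma> \<in> FSym_on S X" "\<tau> \<in> FSym_on S X" and eq: "restrict \<sigma> X = restrict \<tau> X"
    show "\<sigma> = \<tau>"
    proof (rule extensionalityI)
      show "\<sigma> \<in> extensional S" "\<tau> \<in> extensional S"
        using st by (auto simp: FSym_on_def carrier_FSym Bij_def)
      show "\<sigma> x = \<tau> x" if "x \<in> S" for x
        using st that fun_cong[OF eq, of x] by (cases "x \<in> X") (auto simp: FSym_on_def)
    qed
  qed
  show "(\<lambda>\<sigma>. restrict \<sigma> X) ` FSym_on S X \<subseteq> X \<rightarrow>\<^sub>E X"
  proof (clarsimp)
    fix \<sigma> x assume \<sigma>: "\<sigma> \<in> FSym_on S X" and x: "x \<in> X"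
    have b: "bij_betw \<sigma> S S" using \<sigma> by (simp add: FSym_on_def carrier_FSym Bij_def)
    hence "\<sigma> x \<in> S" using x assms by (auto dest: bij_betwE)
    show "\<sigma> x \<in> X"
    proof (rule ccontr)
      assume "\<sigma> x \<notin> X"
      hence "\<sigma> (\<sigma> x) = \<sigma> x" using \<sigma> \<open>\<sigma> x \<in> S\<close> by (simp add: FSym_on_def)
      hence "\<sigma> x = x"
        using b \<open>\<sigma> x \<in> S\<close> x assms by (auto simp: bij_betw_def dest: inj_onD)
      thus False using x \<open>\<sigma> x \<notin> X\<close> by simp
    qed
  qed
qed

text \<open>The support of \<open>h \<cdot> \<sigma>\<close> is the translate by \<open>h\<close> of the support of \<open>\<sigma>\<close>.\<close>

lemma FSym_action_FSym_on:
  assumes H: "group H" and h: "h \<in> carrier H" and X: "X \<subseteq> carrier H"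
    and \<sigma>: "\<sigma> \<in> FSym_on (carrier H) X"
  shows "FSym_action H h \<sigma> \<in> FSym_on (carrier H) (h <#\<^bsub>H\<^esub> X)"
proof -
  interpret group H by (rule H)
  let ?S = "carrier H" and ?\<tau> = "FSym_action H h \<sigma>"
  have canc: "h \<otimes>\<^bsub>H\<^esub> (inv\<^bsub>H\<^esub> h \<otimes>\<^bsub>H\<^esub> x) = x" if "x \<in> ?S" for x
    using h that by (simp flip: m_assoc)
  have mult: "bij_betw (\<lambda>x. g \<otimes>\<^bsub>H\<^esub> x) ?S ?S" if "g \<in> ?S" for g
    using that inj_on_cmult surj_const_mult by (simp add: bij_betw_def)
  have \<sigma>_bij: "bij_betw \<sigma> ?S ?S" and \<sigma>_fin: "finite {x \<in> ?S. \<sigma> x \<noteq> x}"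
    using \<sigma> by (auto simp: FSym_on_def carrier_FSym Bij_def)
  have "bij_betw ((\<lambda>x. h \<otimes>\<^bsub>H\<^esub> x) \<circ> (\<sigma> \<circ> (\<lambda>x. inv\<^bsub>H\<^esub> h \<otimes>\<^bsub>H\<^esub> x))) ?S ?S"
    using h by (intro bij_betw_trans[OF bij_betw_trans[OF mult \<sigma>_bij] mult]) auto
  moreover have "bij_betw ?\<tau> ?S ?S \<longleftrightarrow>
      bij_betw ((\<lambda>x. h \<otimes>\<^bsub>H\<^esub> x) \<circ> (\<sigma> \<circ> (\<lambda>x. inv\<^bsub>H\<^esub> h \<otimes>\<^bsub>H\<^esub> x))) ?S ?S"
    by (rule bij_betw_cong) (simp add: FSym_action_def)
  ultimately have "?\<tau> \<in> Bij ?S" by (simp add: Bij_def FSym_action_def)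
  moreover have moved: "{x \<in> ?S. ?\<tau> x \<noteq> x} \<subseteq> (\<lambda>x. h \<otimes>\<^bsub>H\<^esub> x) ` {x \<in> ?S. \<sigma> x \<noteq> x}"
  proof
    fix x assume x: "x \<in> {x \<in> ?S. ?\<tau> x \<noteq> x}"
    hence "\<sigma> (inv\<^bsub>H\<^esub> h \<otimes>\<^bsub>H\<^esub> x) \<noteq> inv\<^bsub>H\<^esub> h \<otimes>\<^bsub>H\<^esub> x" using canc by (auto simp: FSym_action_def)
    thus "x \<in> (\<lambda>x. h \<otimes>\<^bsub>H\<^esub> x) ` {x \<in> ?S. \<sigma> x \<noteq> x}"
      using x h canc by (intro image_eqI[of _ _ "inv\<^bsub>H\<^esub> h \<otimes>\<^bsub>H\<^esub> x"]) auto
  qed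
  hence "finite {x \<in> ?S. ?\<tau> x \<noteq> x}" using \<sigma>_fin by (meson finite_imageI finite_subset)
  moreover have "{x \<in> ?S. \<sigma> x \<noteq> x} \<subseteq> X" using \<sigma> by (auto simp: FSym_on_def)
  hence "{x \<in> ?S. ?\<tau> x \<noteq> x} \<subseteq> h <#\<^bsub>H\<^esub> X"
    using moved by (fastforce simp: l_coset_def)
  ultimately show ?thesis by (auto simp: FSym_on_def carrier_FSym)
qed

lemma localized_semidirect_Shuffler:
  assumes H: "group H"
  shows "localized_semidirect (FSym (carrier H)) H (FSym_action H) (FSym_on (carrier H))"
proof (intro localized_semidirect.intro localized_semidirect_axioms.intro)
  show "group (semidirect (FSym (carrier H)) H (FSym_action H))"
    using group_Shuffler[OF H] by (simp add: Shuffler_def)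
  show "FSym_on (carrier H) X \<subseteq> FSym_on (carrier H) Y" if "X \<subseteq> Y" for X Y
    using that by (auto simp: FSym_on_def)
  \<comment> \<open>A finitary permutation lives on the set of points that it moves.\<close>
  show "\<exists>X. finite X \<and> X \<subseteq> carrier H \<and> \<sigma> \<in> FSym_on (carrier H) X"
    if "\<sigma> \<in> carrier (FSym (carrier H))" for \<sigma>
    using that
    by (intro exI[of _ "{x \<in> carrier H. \<sigma> x \<noteq> x}"]) (auto simp: FSym_on_def carrier_FSym)
qed (auto intro: H group_FSym subgroup_FSym_on finite_FSym_on FSym_action_FSym_on)

section \<open>Linear maps on the free space\<close>

text \<open>The induction principle says that the basis vectors span; it replaces an explicit
  expansion of a vector as a finite sum.\<close>

lemma free_space_induct:
  assumes K: "field K" and v: "v \<in> carrier (free_space K S)"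
    and zero: "Q (\<lambda>x. \<zero>\<^bsub>K\<^esub>)"
    and step: "\<And>v c u. v \<in> carrier (free_space K S) \<Longrightarrow> c \<in> carrier K \<Longrightarrow> u \<in> S \<Longrightarrow> Q v \<Longrightarrow>
      Q (v \<oplus>\<^bsub>free_space K S\<^esub> c \<odot>\<^bsub>free_space K S\<^esub> basis_vec K u)"
  shows "Q v"
proof -
  interpret K: field K by (rule K)
  have "Q v" if "finite A" "v \<in> carrier (free_space K S)" "{x. v x \<noteq> \<zero>\<^bsub>K\<^esub>} \<subseteq> A" for A v
    using that
  proof (induction A arbitrary: v rule: finite_induct)
    case empty
    hence "v = (\<lambda>x. \<zero>\<^bsub>K\<^esub>)" by auto
    thus ?case using zero by simp
  next
    case (insert u A)
    let ?w = "v(u := \<zero>\<^bsub>K\<^esub>)"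
    have vK: "v x \<in> carrier K" for x using insert.prems(1) by (auto simp: free_space_def)
    have "{x. ?w x \<noteq> \<zero>\<^bsub>K\<^esub>} \<subseteq> {x. v x \<noteq> \<zero>\<^bsub>K\<^esub>}" by auto
    hence w: "?w \<in> carrier (free_space K S)"
      using insert.prems(1) vK by (auto simp: free_space_def intro: finite_subset)
    have Qw: "Q ?w" using insert.prems(2) by (intro insert.IH w) auto
    show ?case
    proof (cases "u \<in> S")
      case True
      have "v = ?w \<oplus>\<^bsub>free_space K S\<^esub> v u \<odot>\<^bsub>free_space K S\<^esub> basis_vec K u"
        using vK by (auto simp: free_space_def basis_vec_def fun_eq_iff)
      thus ?thesis using step[OF w vK True Qw, of u] by simp
    next
      case False
      hence "v u = \<zero>\<^bsub>K\<^esub>" using insert.prems(1) by (auto simp: free_space_def)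
      hence "?w = v" by auto
      thus ?thesis using Qw by simp
    qed
  qed
  thus ?thesis using v by (auto simp: free_space_def)
qed

lemma module_hom_free_space_zero:
  assumes K: "field K" and f: "f \<in> module_hom K (free_space K S) (free_space K S)"
  shows "f (\<lambda>x. \<zero>\<^bsub>K\<^esub>) = (\<lambda>x. \<zero>\<^bsub>K\<^esub>)"
proof -
  interpret K: field K by (rule K)
  have z: "(\<lambda>x. \<zero>\<^bsub>K\<^esub>) \<in> carrier (free_space K S)" by (auto simp: free_space_def)
  hence "f (\<zero>\<^bsub>K\<^esub> \<odot>\<^bsub>free_space K S\<^esub> (\<lambda>x. \<zero>\<^bsub>K\<^esub>)) = \<zero>\<^bsub>K\<^esub> \<odot>\<^bsub>free_space K S\<^esub> f (\<lambda>x. \<zero>\<^bsub>K\<^esub>)"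
    and "f (\<lambda>x. \<zero>\<^bsub>K\<^esub>) \<in> carrier (free_space K S)"
    using f by (auto simp: module_hom_def)
  thus ?thesis by (auto simp: free_space_def fun_eq_iff image_subset_iff)
qed

lemma module_hom_free_space_step:
  assumes K: "field K" and f: "f \<in> module_hom K (free_space K S) (free_space K S)"
    and v: "v \<in> carrier (free_space K S)" and c: "c \<in> carrier K" and u: "u \<in> S"
  shows "f (v \<oplus>\<^bsub>free_space K S\<^esub> c \<odot>\<^bsub>free_space K S\<^esub> basis_vec K u) =
    f v \<oplus>\<^bsub>free_space K S\<^esub> c \<odot>\<^bsub>free_space K S\<^esub> f (basis_vec K u)"
proof -
  interpret V: vectorspace K "free_space K S" by (rule vectorspace_free_space[OF K])
  show ?thesis
    using f v c basis_vec_in_free_space[OF K u] V.smult_closed by (simp add: module_hom_def)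
qed

lemma module_hom_free_space_eqI:
  assumes K: "field K" and f: "f \<in> module_hom K (free_space K S) (free_space K S)"
    and g: "g \<in> module_hom K (free_space K S) (free_space K S)"
    and eq: "\<And>u. u \<in> S \<Longrightarrow> f (basis_vec K u) = g (basis_vec K u)"
    and v: "v \<in> carrier (free_space K S)"
  shows "f v = g v"
  using v
  by (rule free_space_induct[OF K])
    (simp_all add: module_hom_free_space_zero[OF K f] module_hom_free_space_zero[OF K g]
      module_hom_free_space_step[OF K] f g eq)

section \<open>Finitary linear automorphisms\<close>

text \<open>The copy of the general linear group of the span of \<open>X\<close>. The first condition says that \<open>f\<close> is
  the identity modulo the span of \<open>X\<close>. It is equivalent, given the second one, to \<open>f\<close> preserving that
  span; but unlike a preserved subspace it visibly passes to inverses, with no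
  appeal to finite dimension.\<close>

definition FGL_on :: "('f, 'r) ring_scheme \<Rightarrow> 'a set \<Rightarrow> 'a set \<Rightarrow> (('a \<Rightarrow> 'f) \<Rightarrow> ('a \<Rightarrow> 'f)) set" where
  "FGL_on K S X = {f \<in> carrier (FGL K S).
     (\<forall>v \<in> carrier (free_space K S). \<forall>x \<in> S - X. f v x = v x) \<and>
     (\<forall>u \<in> S - X. f (basis_vec K u) = basis_vec K u)}"

lemma carrier_FGL: "carrier (FGL K S) = {f \<in> Bij (carrier (free_space K S)).
    f \<in> module_hom K (free_space K S) (free_space K S) \<and>
    finite {u \<in> S. f (basis_vec K u) \<noteq> basis_vec K u}}"
  by (simp add: FGL_def)

lemma group_FGL: "field K \<Longrightarrow> group (FGL K S)"
  unfolding FGL_def by (rule subgroup.subgroup_is_group[OF subgroup_FGL group_BijGroup])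

lemma subgroup_FGL_on:
  assumes K: "field K"
  shows "subgroup (FGL_on K S X) (FGL K S)"
proof -
  interpret group "FGL K S" by (rule group_FGL[OF K])
  let ?V = "carrier (free_space K S)"
  note basis = basis_vec_in_free_space[OF K]
  show ?thesis
  proof (rule subgroupI)
    have "\<one>\<^bsub>FGL K S\<^esub> = (\<lambda>v\<in>?V. v)" by (simp add: FGL_def BijGroup_simps)
    hence "\<one>\<^bsub>FGL K S\<^esub> \<in> FGL_on K S X"
      using one_closed by (auto simp: FGL_on_def basis)
    thus "FGL_on K S X \<noteq> {}" by blast
  next
    fix f assume f: "f \<in> FGL_on K S X"
    let ?g = "inv\<^bsub>FGL K S\<^esub> f"
    have c: "f \<in> carrier (FGL K S)" using f by (simp add: FGL_on_def)
    have g: "?g v \<in> ?V" "f (?g v) = v" "?g (f v) = v" if "v \<in> ?V" for v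
      using inv_subgroup_BijGroup[OF subgroup_FGL[OF K], of f S v] c that by (simp_all add: FGL_def)
    have "?g v x = v x" if "v \<in> ?V" "x \<in> S - X" for v x
    proof -
      have "f (?g v) x = ?g v x" using f g(1) that by (auto simp: FGL_on_def)
      thus ?thesis using g(2) that by simp
    qed
    moreover have "?g (basis_vec K u) = basis_vec K u" if "u \<in> S - X" for u
    proof -
      have "f (basis_vec K u) = basis_vec K u" using f that by (auto simp: FGL_on_def)
      thus ?thesis using g(3)[OF basis, of u] that by simp
    qed
    ultimately show "?g \<in> FGL_on K S X" using c by (auto simp: FGL_on_def)
  next
    fix f g assume fg: "f \<in> FGL_on K S X" "g \<in> FGL_on K S X"
    hence c: "f \<in> carrier (FGL K S)" "g \<in> carrier (FGL K S)" by (simp_all add: FGL_on_def)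
    hence "f \<otimes>\<^bsub>FGL K S\<^esub> g = compose ?V f g" by (simp add: FGL_def BijGroup_simps)
    moreover have "g v \<in> ?V" if "v \<in> ?V" for v
      using c that by (auto simp: carrier_FGL module_hom_def)
    ultimately show "f \<otimes>\<^bsub>FGL K S\<^esub> g \<in> FGL_on K S X"
      using fg m_closed[OF c] by (auto simp: FGL_on_def compose_def basis)
  qed (auto simp: FGL_on_def)
qed

text \<open>An element is determined by the images of the basis vectors indexed by \<open>X\<close>, which lie in the
  span of \<open>X\<close>; that span is finite because \<open>K\<close> and \<open>X\<close> are.\<close>

lemma finite_FGL_on:
  assumes K: "field K" and fin: "finite (carrier K)" and X: "finite X" "X \<subseteq> S"
  shows "finite (FGL_on K S X)"
proof (rule inj_on_finite)
  interpret K: field K by (rule K)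
  let ?V = "carrier (free_space K S)"
  let ?VX = "{v. \<forall>x. (x \<in> X \<longrightarrow> v x \<in> carrier K) \<and> (x \<notin> X \<longrightarrow> v x = \<zero>\<^bsub>K\<^esub>)}"
  show "finite (X \<rightarrow>\<^sub>E ?VX)"
    using finite_set_of_finite_funs[OF X(1) fin] by (intro finite_PiE X)
  show "(\<lambda>f. \<lambda>u\<in>X. f (basis_vec K u)) ` FGL_on K S X \<subseteq> X \<rightarrow>\<^sub>E ?VX"
  proof (clarsimp, intro conjI impI)
    fix f u x assume f: "f \<in> FGL_on K S X" and u: "u \<in> X"
    have e: "basis_vec K u \<in> ?V" using u X by (intro basis_vec_in_free_space K) auto
    have fe: "f (basis_vec K u) \<in> ?V"
      using f e by (auto simp: FGL_on_def carrier_FGL module_hom_def)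
    thus "f (basis_vec K u) x \<in> carrier K" by (auto simp: free_space_def)
    show "f (basis_vec K u) x = \<zero>\<^bsub>K\<^esub>" if "x \<notin> X"
    proof (cases "x \<in> S")
      case True
      hence "f (basis_vec K u) x = basis_vec K u x" using f e that by (auto simp: FGL_on_def)
      thus ?thesis using u that by (auto simp: basis_vec_def)
    next
      case False
      thus ?thesis using fe by (auto simp: free_space_def)
    qed
  qed
  show "inj_on (\<lambda>f. \<lambda>u\<in>X. f (basis_vec K u)) (FGL_on K S X)"
  proof (rule inj_onI)
    fix f g assume fg: "f \<in> FGL_on K S X" "g \<in> FGL_on K S X"
      and eq: "(\<lambda>u\<in>X. f (basis_vec K u)) = (\<lambda>u\<in>X. g (basis_vec K u))"
    have agree: "f (basis_vec K u) = g (basis_vec K u)" if "u \<in> S" for u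
      using fg that fun_cong[OF eq, of u] by (cases "u \<in> X") (auto simp: FGL_on_def)
    show "f = g"
    proof (rule extensionalityI)
      show "f \<in> extensional ?V" "g \<in> extensional ?V"
        using fg by (auto simp: FGL_on_def carrier_FGL Bij_def)
      show "f v = g v" if "v \<in> ?V" for v
        by (rule module_hom_free_space_eqI[where f = f and g = g and v = v, OF K _ _ agree that])
          (use fg in \<open>simp_all add: FGL_on_def carrier_FGL\<close>)
    qed
  qed
qed

text \<open>The set of indices of moved basis vectors is too small in general, as the image of a moved
  vector may involve further basis vectors; adding the supports of these images is enough.\<close>

lemma FGL_on_exhausts:
  assumes K: "field K" and f: "f \<in> carrier (FGL K S)"
  shows "\<exists>X. finite X \<and> X \<subseteq> S \<and> f \<in> FGL_on K S X"
proof -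
  interpret K: field K by (rule K)
  let ?V = "carrier (free_space K S)"
  define A where "A = {u \<in> S. f (basis_vec K u) \<noteq> basis_vec K u}"
  define X where "X = A \<union> (\<Union>u\<in>A. {x. f (basis_vec K u) x \<noteq> \<zero>\<^bsub>K\<^esub>})"
  have lin: "f \<in> module_hom K (free_space K S) (free_space K S)" and A: "finite A" "A \<subseteq> S"
    using f by (auto simp: carrier_FGL A_def)
  have fe: "f (basis_vec K u) \<in> ?V" if "u \<in> S" for u
    using lin basis_vec_in_free_space[OF K that] by (auto simp: module_hom_def)
  hence X: "finite X" "X \<subseteq> S"
    using A by (auto simp: X_def free_space_def)
  have basis: "f (basis_vec K u) x = basis_vec K u x" if "u \<in> S" "x \<in> S - X" for u x
    using that by (cases "u \<in> A") (auto simp: X_def A_def basis_vec_def)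
  have "\<forall>x\<in>S - X. f v x = v x" if "v \<in> ?V" for v
    using that
  proof (rule free_space_induct[OF K])
    show "\<forall>x\<in>S - X. f (\<lambda>x. \<zero>\<^bsub>K\<^esub>) x = \<zero>\<^bsub>K\<^esub>"
      by (simp add: module_hom_free_space_zero[OF K lin])
  next
    fix v c u assume *: "v \<in> ?V" "c \<in> carrier K" "u \<in> S" "\<forall>x\<in>S - X. f v x = v x"
    show "\<forall>x\<in>S - X. f (v \<oplus>\<^bsub>free_space K S\<^esub> c \<odot>\<^bsub>free_space K S\<^esub> basis_vec K u) x =
        (v \<oplus>\<^bsub>free_space K S\<^esub> c \<odot>\<^bsub>free_space K S\<^esub> basis_vec K u) x"
      unfolding module_hom_free_space_step[OF K lin *(1-3)]
      using basis[OF *(3)] *(4) by (simp add: free_space_def)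
  qed
  moreover have "\<forall>u\<in>S - X. f (basis_vec K u) = basis_vec K u"
    by (simp add: X_def A_def)
  ultimately show ?thesis using X f by (auto simp: FGL_on_def)
qed

lemma FGL_action_apply:
  assumes H: "group H" and K: "field K" and h: "h \<in> carrier H"
    and f: "f \<in> carrier (FGL K (carrier H))" and v: "v \<in> carrier (free_space K (carrier H))"
  shows "FGL_action K H h f v = translation K H h (f (translation K H (inv\<^bsub>H\<^esub> h) v))"
proof -
  let ?B = "BijGroup (carrier (free_space K (carrier H)))"
  interpret group H by (rule H)
  interpret T: group_hom H ?B "translation K H"
    by (simp add: group_hom_def group_hom_axioms_def H group_BijGroup translation_hom K)
  have T: "translation K H g \<in> Bij (carrier (free_space K (carrier H)))" if "g \<in> carrier H" for g
    using T.hom_closed[OF that] by (simp add: BijGroup_simps)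
  have "FGL_action K H h f =
      translation K H h \<otimes>\<^bsub>?B\<^esub> f \<otimes>\<^bsub>?B\<^esub> translation K H (inv\<^bsub>H\<^esub> h)"
    using h by (simp add: FGL_action_def Let_def)
  moreover have "f \<in> Bij (carrier (free_space K (carrier H)))" using f by (simp add: carrier_FGL)
  moreover have "translation K H (inv\<^bsub>H\<^esub> h) v \<in> carrier (free_space K (carrier H))"
    using Bij_imp_funcset[OF T[of "inv\<^bsub>H\<^esub> h"]] h v by (simp add: Pi_iff del: T.hom_inv)
  moreover have "translation K H h \<in> Bij (carrier (free_space K (carrier H)))"
    and "translation K H (inv\<^bsub>H\<^esub> h) \<in> Bij (carrier (free_space K (carrier H)))"
    using h by (auto intro: T simp del: T.hom_inv)
  ultimately show ?thesis
    using v by (simp add: BijGroup_simps(2) compose_Bij compose_eq del: T.hom_inv)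
qed

text \<open>Conjugation by a translation stays in the linear bijections, a subgroup containing both factors,
  and merely translates the set of moved basis vectors.\<close>

lemma FGL_action_closed:
  assumes H: "group H" and K: "field K" and h: "h \<in> carrier H"
    and f: "f \<in> carrier (FGL K (carrier H))"
  shows "FGL_action K H h f \<in> carrier (FGL K (carrier H))"
proof -
  let ?V = "free_space K (carrier H)"
  let ?L = "Bij (carrier ?V) \<inter> module_hom K ?V ?V"
  interpret L: subgroup ?L "BijGroup (carrier ?V)" by (rule subgroup_linear_Bij[OF K])
  note T = translation_hom[OF H K]
  have action: "FGL_action K H h f = translation K H h \<otimes>\<^bsub>BijGroup (carrier ?V)\<^esub> f
      \<otimes>\<^bsub>BijGroup (carrier ?V)\<^esub> inv\<^bsub>BijGroup (carrier ?V)\<^esub> (translation K H h)"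
    by (simp add: FGL_action_def Let_def)
  have "translation K H h \<in> ?L"
    using hom_in_carrier[OF T h] translation_linear[OF H K h] by (simp add: BijGroup_simps)
  hence "FGL_action K H h f \<in> ?L"
    unfolding action using f group_BijGroup
    by (intro L.m_closed L.m_inv_closed) (auto simp: carrier_FGL)
  moreover have "basis_vec K ` carrier H \<subseteq> carrier ?V"
    using basis_vec_in_free_space[OF K] by auto
  hence "finite {u \<in> carrier H. FGL_action K H h f (basis_vec K u) \<noteq> basis_vec K u}"
    unfolding action using f
    by (intro finite_support_conjugation[OF H _ T translation_basis_vec[OF H K] h])
      (auto simp: carrier_FGL)
  ultimately show ?thesis by (simp add: carrier_FGL)
qed

lemma FGL_action_FGL_on:
  assumes H: "group H" and K: "field K" and h: "h \<in> carrier H" and X: "X \<subseteq> carrier H"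
    and f: "f \<in> FGL_on K (carrier H) X"
  shows "FGL_action K H h f \<in> FGL_on K (carrier H) (h <#\<^bsub>H\<^esub> X)"
proof -
  interpret group H by (rule H)
  let ?S = "carrier H" and ?V = "carrier (free_space K (carrier H))"
  let ?T = "translation K H"
  have c: "f \<in> carrier (FGL K ?S)" using f by (simp add: FGL_on_def)
  have T: "?T g v \<in> ?V" if "g \<in> ?S" "v \<in> ?V" for g v
    using translation_linear[OF H K that(1)] that(2) by (auto simp: module_hom_def)
  have fV: "f v \<in> ?V" if "v \<in> ?V" for v
    using c that by (auto simp: carrier_FGL module_hom_def)
  have canc: "h \<otimes>\<^bsub>H\<^esub> (inv\<^bsub>H\<^esub> h \<otimes>\<^bsub>H\<^esub> x) = x" if "x \<in> ?S" for x
    using h that by (simp flip: m_assoc)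
  have off: "inv\<^bsub>H\<^esub> h \<otimes>\<^bsub>H\<^esub> x \<in> ?S - X" if "x \<in> ?S - (h <#\<^bsub>H\<^esub> X)" for x
  proof -
    have "inv\<^bsub>H\<^esub> h \<otimes>\<^bsub>H\<^esub> x \<notin> X"
    proof
      assume "inv\<^bsub>H\<^esub> h \<otimes>\<^bsub>H\<^esub> x \<in> X"
      hence "h \<otimes>\<^bsub>H\<^esub> (inv\<^bsub>H\<^esub> h \<otimes>\<^bsub>H\<^esub> x) \<in> h <#\<^bsub>H\<^esub> X" by (auto simp: l_coset_def)
      thus False using that canc by simp
    qed
    thus ?thesis using that h by simp
  qed
  have "FGL_action K H h f v x = v x" if v: "v \<in> ?V" and x: "x \<in> ?S - (h <#\<^bsub>H\<^esub> X)" for v x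
  proof -
    let ?w = "?T (inv\<^bsub>H\<^esub> h) v"
    have w: "?w \<in> ?V" using h v by (intro T) auto
    have "FGL_action K H h f v x = f ?w (inv\<^bsub>H\<^esub> h \<otimes>\<^bsub>H\<^esub> x)"
      using FGL_action_apply[OF H K h c v] fV[OF w] x by (simp add: translation_def)
    also have "\<dots> = ?w (inv\<^bsub>H\<^esub> h \<otimes>\<^bsub>H\<^esub> x)" using f w off[OF x] by (auto simp: FGL_on_def)
    also have "\<dots> = v x" using v x h canc by (simp add: translation_def)
    finally show ?thesis .
  qed
  moreover have "FGL_action K H h f (basis_vec K u) = basis_vec K u"
    if u: "u \<in> ?S - (h <#\<^bsub>H\<^esub> X)" for u
  proof -
    have "FGL_action K H h f (basis_vec K u) = ?T h (f (basis_vec K (inv\<^bsub>H\<^esub> h \<otimes>\<^bsub>H\<^esub> u)))"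
      using FGL_action_apply[OF H K h c basis_vec_in_free_space[OF K]] u h
      by (simp add: translation_basis_vec[OF H K])
    also have "\<dots> = ?T h (basis_vec K (inv\<^bsub>H\<^esub> h \<otimes>\<^bsub>H\<^esub> u))"
      using f off[OF u] by (auto simp: FGL_on_def)
    also have "\<dots> = basis_vec K u"
      using u h canc by (simp add: translation_basis_vec[OF H K])
    finally show ?thesis .
  qed
  ultimately show ?thesis
    using FGL_action_closed[OF H K h c] by (simp add: FGL_on_def)
qed

lemma localized_semidirect_Cloner:
  assumes H: "group H" and K: "field K" and fin: "finite (carrier K)"
  shows "localized_semidirect (FGL K (carrier H)) H (FGL_action K H) (FGL_on K (carrier H))"
proof (intro localized_semidirect.intro localized_semidirect_axioms.intro)
  show "group (semidirect (FGL K (carrier H)) H (FGL_action K H))"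
    using group_Cloner[OF H K] by (simp add: Cloner_def)
  show "FGL_on K (carrier H) X \<subseteq> FGL_on K (carrier H) Y" if "X \<subseteq> Y" for X Y
    using that by (auto simp: FGL_on_def)
qed (auto intro: H group_FGL[OF K] subgroup_FGL_on[OF K] finite_FGL_on[OF K fin]
    FGL_action_FGL_on[OF H K] FGL_on_exhausts[OF K])

section \<open>Shufflers and cloners\<close>

theorem propositionB:
  fixes H :: "('h, 'm) monoid_scheme" and K :: "('f, 'r) ring_scheme"
  assumes "group H" and "finitely_generated H" and "amenable H"
    and "field K" and "finite (carrier K)"
    and "\<exists>F. folner_tiling_sequence H F"
  shows "(\<exists>F. folner_tiling_sequence (Shuffler H) F) \<and> (\<exists>F. folner_tiling_sequence (Cloner K H) F)"
proof -
  interpret S: localized_semidirect "FSym (carrier H)" H "FSym_action H" "FSym_on (carrier H)"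
    using assms by (intro localized_semidirect_Shuffler)
  interpret C: localized_semidirect "FGL K (carrier H)" H "FGL_action K H" "FGL_on K (carrier H)"
    using assms by (intro localized_semidirect_Cloner)
  show ?thesis
    using assms(6) S.folner_tiling_sequence_lift C.folner_tiling_sequence_lift
    by (auto simp: Shuffler_def Cloner_def)
qed

end
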